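(* Let $\Omega\subset\mathbb C^n$ be a domain, let $f,g$ be smooth real functions on $\Omega$ with $(f_{i\bar j})>0$ and $(g_{i\bar j})>0$, and let $\phi=f-g$. Then $$\square\log(n-\square\phi)\ge-\|Ric\|_f-\dot{\mathcal R}\,(n-\square\phi).$$
   Context: $f_{i\bar j}=\partial^2f/\partial z_i\partial\bar z_j$; $(f^{i\bar j})$, $(g^{i\bar j})$ are the inverse matrices; $\square=\sum f^{i\bar j}\partial^2/\partial z_i\partial\bar z_j$, so that $n-\square\phi=\sum f^{i\bar j}g_{i\bar j}>0$. $Ric$ is the Ricci tensor of $\omega_f$, $R_{i\bar j}=-\partial_i\partial_{\bar j}\log\det(f_{k\bar l})$, and $\|Ric\|_f^2=\sum f^{i\bar j}f^{k\bar l}R_{i\bar l}R_{k\bar j}$. $\dot R_{i\bar jk\bar l}=-\frac{\partial^2g_{i\bar j}}{\partial z_k\partial\bar z_l}+\sum g^{p\bar q}\frac{\partial g_{i\bar q}}{\partial z_k}\frac{\partial g_{p\bar j}}{\partial\bar z_l}$ is the curvature tensor of $\omega_g$ and $$\dot{\mathcal R}=\sqrt{\sum g^{m\bar n}g^{k\bar l}g^{i\bar j}g^{s\bar t}\dot R_{m\bar li\bar t}\dot R_{k\bar ns\bar j}}.$$ *)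

theory Defs
  imports "HOL-Analysis.Analysis"
begin

text \<open>
  In finite dimension, a function is of class C^(k+1) on an open set iff it is differentiable
  there and all its directional derivatives are of class C^k.
\<close>

primrec C_k_on :: "nat \<Rightarrow> ('a::real_normed_vector \<Rightarrow> 'b::real_normed_vector) \<Rightarrow> 'a set \<Rightarrow> bool" where
  "C_k_on 0 h S \<longleftrightarrow> continuous_on S h"
| "C_k_on (Suc k) h S \<longleftrightarrow>
     (\<forall>x\<in>S. h differentiable (at x)) \<and> (\<forall>v. C_k_on k (\<lambda>x. frechet_derivative h (at x) v) S)"

definition smooth_on :: "('a::real_normed_vector \<Rightarrow> 'b::real_normed_vector) \<Rightarrow> 'a set \<Rightarrow> bool" where
  "smooth_on h S \<longleftrightarrow> (\<forall>k. C_k_on k h S)"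

text \<open>
  With \<open>z\<^sub>i = x\<^sub>i + \<i> y\<^sub>i\<close>, the direction of \<open>x\<^sub>i\<close> is \<open>axis i 1\<close> and that of \<open>y\<^sub>i\<close> is \<open>axis i \<i>\<close>;
  \<open>d_z i\<close> and \<open>d_zbar i\<close> are the Wirtinger derivatives in \<open>z\<^sub>i\<close> and its conjugate.
\<close>

definition d_z :: "'n::finite \<Rightarrow> (complex^'n \<Rightarrow> complex) \<Rightarrow> complex^'n \<Rightarrow> complex" where
  "d_z i F z = (frechet_derivative F (at z) (axis i 1)
                 - \<i> * frechet_derivative F (at z) (axis i \<i>)) / 2"

definition d_zbar :: "'n::finite \<Rightarrow> (complex^'n \<Rightarrow> complex) \<Rightarrow> complex^'n \<Rightarrow> complex" where
  "d_zbar i F z = (frechet_derivative F (at z) (axis i 1)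
                 + \<i> * frechet_derivative F (at z) (axis i \<i>)) / 2"

text \<open>The matrix with entry \<open>\<partial>\<^sup>2h / \<partial>z\<^sub>i \<partial>zbar\<^sub>j\<close> in row \<open>i\<close> and column \<open>j\<close>.\<close>

definition complex_hessian :: "(complex^'n::finite \<Rightarrow> real) \<Rightarrow> complex^'n \<Rightarrow> complex^'n^'n" where
  "complex_hessian h z = (\<chi> i j. d_z i (d_zbar j (\<lambda>w. complex_of_real (h w))) z)"

definition hermitian_pos_def :: "complex^'n::finite^'n \<Rightarrow> bool" where
  "hermitian_pos_def A \<longleftrightarrow>
     (\<forall>i j. A $ j $ i = cnj (A $ i $ j)) \<and>
     (\<forall>v. v \<noteq> 0 \<longrightarrow> Re (\<Sum>i\<in>UNIV. \<Sum>j\<in>UNIV. A $ i $ j * v $ i * cnj (v $ j)) > 0)"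

text \<open>
  \<open>inv_metric h z i j\<close> is the coefficient of the inverse matrix with first (unbarred) index \<open>i\<close>
  and second (barred) index \<open>j\<close>. As usual in Kaehler geometry it is normalised by
  \<open>\<Sum>j. inv_metric h z i j * h\<^sub>k\<^sub>j = \<delta>\<^sub>i\<^sub>k\<close>, hence the transposition. (Only with this normalisation is
  the contraction of the inverse of \<open>f\<close> with the Hessian of \<open>f\<close> equal to the dimension.)
\<close>

definition inv_metric :: "(complex^'n::finite \<Rightarrow> real) \<Rightarrow> complex^'n \<Rightarrow> 'n \<Rightarrow> 'n \<Rightarrow> complex" where
  "inv_metric h z i j = matrix_inv (complex_hessian h z) $ j $ i"

text \<open>
  For real smooth functions with positive definite Hessian, the complex sums and the determinant
  under \<open>Re\<close> in the following definitions are real; \<open>Re\<close> only changes their type.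
\<close>

definition complex_laplacian :: "(complex^'n::finite \<Rightarrow> real) \<Rightarrow> (complex^'n \<Rightarrow> real) \<Rightarrow> complex^'n \<Rightarrow> real" where
  "complex_laplacian f h z = Re (\<Sum>i\<in>UNIV. \<Sum>j\<in>UNIV. inv_metric f z i j * complex_hessian h z $ i $ j)"

definition ricci :: "(complex^'n::finite \<Rightarrow> real) \<Rightarrow> complex^'n \<Rightarrow> 'n \<Rightarrow> 'n \<Rightarrow> complex" where
  "ricci f z i j = - (complex_hessian (\<lambda>w. ln (Re (det (complex_hessian f w)))) z $ i $ j)"

definition ricci_norm :: "(complex^'n::finite \<Rightarrow> real) \<Rightarrow> complex^'n \<Rightarrow> real" where
  "ricci_norm f z = sqrt (Re (\<Sum>i\<in>UNIV. \<Sum>j\<in>UNIV. \<Sum>k\<in>UNIV. \<Sum>l\<in>UNIV.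
     inv_metric f z i j * inv_metric f z k l * ricci f z i l * ricci f z k j))"

text \<open>In \<open>curvature g z i j k l\<close> the indices \<open>j\<close> and \<open>l\<close> are the barred ones.\<close>

definition curvature ::
  "(complex^'n::finite \<Rightarrow> real) \<Rightarrow> complex^'n \<Rightarrow> 'n \<Rightarrow> 'n \<Rightarrow> 'n \<Rightarrow> 'n \<Rightarrow> complex" where
  "curvature g z i j k l =
     - d_z k (d_zbar l (\<lambda>w. complex_hessian g w $ i $ j)) z
     + (\<Sum>p\<in>UNIV. \<Sum>q\<in>UNIV. inv_metric g z p q
          * d_z k (\<lambda>w. complex_hessian g w $ i $ q) z
          * d_zbar l (\<lambda>w. complex_hessian g w $ p $ j) z)"

definition curvature_norm :: "(complex^'n::finite \<Rightarrow> real) \<Rightarrow> complex^'n \<Rightarrow> real" where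
  "curvature_norm g z = sqrt (Re (\<Sum>m\<in>UNIV. \<Sum>n\<in>UNIV. \<Sum>k\<in>UNIV. \<Sum>l\<in>UNIV.
     \<Sum>i\<in>UNIV. \<Sum>j\<in>UNIV. \<Sum>s\<in>UNIV. \<Sum>t\<in>UNIV.
       inv_metric g z m n * inv_metric g z k l * inv_metric g z i j * inv_metric g z s t
         * curvature g z m l i t * curvature g z k n s j))"

end

theory Submission
  imports Defs
begin

text \<open>
  Write \<open>F\<close>, \<open>G\<close> for the complex Hessians of \<open>f\<close>, \<open>g\<close> and \<open>P\<close>, \<open>Q\<close> for their inverses, so that
  \<open>u = n - \<box>\<phi> = tr (P G)\<close>. Differentiating twice and using the symmetries of the derivatives of \<open>f\<close>,
  \<open>\<box>u\<close> becomes a Ricci term, minus a curvature term of \<open>g\<close>, plus the squared norm of the covariant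
  derivatives \<open>A\<^sub>k = G\<^sub>k - F\<^sub>k P G\<close>; all this holds in arbitrary coordinates, so no normal coordinates are
  needed. As \<open>tr (P A\<^sub>k) = u\<^sub>k\<close>, the Cauchy-Schwarz inequality lets the last term absorb
  \<open>|\<partial>u|\<^sup>2 / u\<close>. The Ricci and the curvature term are both pairings of a hermitian matrix with a positive
  semidefinite one, whose norm is at most its trace, namely \<open>u\<close> and \<open>u\<^sup>2\<close> respectively.
\<close>

section \<open>Hermitian matrices\<close>

text \<open>The matrices \<open>A\<^sub>k\<close> come from completing the square: the part of
  \<open>\<box>u\<close> that mixes derivatives of \<open>f\<close> and \<open>g\<close> consists of
  the cross terms of \<open>tr (P A\<^sub>k Q ctrans A\<^sub>l)\<close>, and the part of that trace
  quadratic in the derivatives of \<open>g\<close> alone cancels against the curvature of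
  \<open>g\<close>. Measuring \<open>A\<^sub>k\<close> by \<open>P\<close> on one side and by
  \<open>Q\<close> on the other makes the constant in the Cauchy-Schwarz step exactly
  \<open>u\<close>. In place of a simultaneous diagonalisation, each metric is factored as
  \<open>T ** ctrans T\<close>; with the inverse factors all contractions turn into Frobenius norms.
  The Ricci term first appears as the curvature of \<open>f\<close> contracted over the derivative
  indices, while the Ricci tensor contracts the matrix indices; the symmetry of the fourth
  derivatives of \<open>f\<close> links the two. Smoothness is carried only through linear
  operations, which suffices for Hessians and their derivatives. The trace \<open>u\<close>, which
  involves an inverse matrix, is only shown to be differentiable together with its first
  derivatives.\<close>

definition ctrans :: "complex^'n^'m \<Rightarrow> complex^'m^'n" where
  "ctrans A = (\<chi> i j. cnj (A $ j $ i))"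

lemma ctrans_nth [simp]: "ctrans A $ i $ j = cnj (A $ j $ i)"
  by (simp add: ctrans_def)

lemma ctrans_ctrans [simp]: "ctrans (ctrans A) = A"
  by (simp add: vec_eq_iff)

lemma ctrans_matrix_mult:
  fixes A :: "complex^'n::finite^'m" and B :: "complex^'p^'n"
  shows "ctrans (A ** B) = ctrans B ** ctrans A"
  by (simp add: vec_eq_iff matrix_matrix_mult_def mult.commute)

lemma ctrans_mat_1 [simp]: "ctrans (mat 1) = mat 1"
  by (auto simp: vec_eq_iff mat_def)

lemma ctrans_diff: "ctrans (A - B) = ctrans A - ctrans B"
  by (simp add: vec_eq_iff)

lemma trace_ctrans: "trace (ctrans A) = cnj (trace A)"
  by (simp add: trace_def)

lemma matrix_add_rdistrib:
  fixes A B :: "'a::semiring_1^'n::finite^'m"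
  shows "(A + B) ** C = A ** C + B ** C"
  by (simp add: vec_eq_iff matrix_matrix_mult_def sum.distrib distrib_right)

lemma matrix_diff_ldistrib:
  fixes A :: "'a::ring_1^'n::finite^'m"
  shows "A ** (B - C) = A ** B - A ** C"
  by (simp add: vec_eq_iff matrix_matrix_mult_def sum_subtractf right_diff_distrib)

lemma matrix_diff_rdistrib:
  fixes A B :: "'a::ring_1^'n::finite^'m"
  shows "(A - B) ** C = A ** C - B ** C"
  by (simp add: vec_eq_iff matrix_matrix_mult_def sum_subtractf left_diff_distrib)

lemma matrix_minus_mult:
  fixes A :: "'a::ring_1^'n::finite^'m"
  shows "(- A) ** B = - (A ** B)" and "A ** (- B) = - (A ** B)"
  by (simp_all add: vec_eq_iff matrix_matrix_mult_def sum_negf)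

lemma trace_minus:
  fixes A :: "'a::ring_1^'n::finite^'n"
  shows "trace (- A) = - trace A"
  by (simp add: trace_def sum_negf)

lemma norm_matrix_power2:
  fixes A :: "complex^'n::finite^'m::finite"
  shows "(norm A)\<^sup>2 = (\<Sum>i\<in>UNIV. \<Sum>j\<in>UNIV. (norm (A $ i $ j))\<^sup>2)"
  by (simp add: norm_vec_def L2_set_def sum_nonneg)

lemma norm_ctrans [simp]:
  fixes A :: "complex^'n::finite^'m::finite"
  shows "norm (ctrans A) = norm A"
proof -
  have "(norm (ctrans A))\<^sup>2 = (norm A)\<^sup>2"
    unfolding norm_matrix_power2 by (simp add: sum.swap[of _ "UNIV::'n set"])
  then show ?thesis
    by simp
qed

lemma trace_mult_ctrans:
  fixes A :: "complex^'n::finite^'m::finite"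
  shows "trace (A ** ctrans A) = of_real ((norm A)\<^sup>2)"
  unfolding norm_matrix_power2
  by (simp add: trace_def matrix_matrix_mult_def complex_norm_square[symmetric])

text \<open>The norm of a matrix is the L2 norm of the L2 norms of its rows, that is, the Frobenius
  norm; so Cauchy-Schwarz is applied once within the rows and once across them.\<close>

lemma norm_trace_mult_le:
  fixes A :: "complex^'n::finite^'m::finite" and B :: "complex^'m^'n"
  shows "norm (trace (A ** B)) \<le> norm A * norm B"
proof -
  have "norm (trace (A ** B)) \<le> (\<Sum>i\<in>UNIV. \<Sum>j\<in>UNIV. norm (A $ i $ j) * norm (ctrans B $ i $ j))"
    unfolding trace_def matrix_matrix_mult_def
    by (auto intro!: order_trans[OF norm_sum] sum_mono simp: norm_mult)
  also have "\<dots> \<le> (\<Sum>i\<in>UNIV. norm (A $ i) * norm (ctrans B $ i))"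
    unfolding norm_vec_def[of "_ $ _"]
    by (intro sum_mono order_trans[OF _ L2_set_mult_ineq]) simp
  also have "\<dots> \<le> norm A * norm (ctrans B)"
    unfolding norm_vec_def[of A] norm_vec_def[of "ctrans B"]
    by (intro order_trans[OF _ L2_set_mult_ineq]) simp
  finally show ?thesis by simp
qed

lemma norm_matrix_mult_le:
  fixes A :: "complex^'n::finite^'m::finite" and B :: "complex^'p::finite^'n"
  shows "norm (A ** B) \<le> norm A * norm B"
proof -
  have *: "norm ((A ** B) $ i $ j) \<le> norm (A $ i) * norm (ctrans B $ j)" for i j
  proof -
    have "norm ((A ** B) $ i $ j) \<le> (\<Sum>k\<in>UNIV. norm (A $ i $ k) * norm (ctrans B $ j $ k))"
      unfolding matrix_matrix_mult_def
      by (auto intro!: order_trans[OF norm_sum] sum_mono simp: norm_mult)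
    also have "\<dots> \<le> norm (A $ i) * norm (ctrans B $ j)"
      unfolding norm_vec_def[of "_ $ _"]
      by (intro order_trans[OF _ L2_set_mult_ineq]) simp
    finally show ?thesis .
  qed
  have sq: "(norm C)\<^sup>2 = (\<Sum>i\<in>UNIV. (norm (C $ i))\<^sup>2)" for C :: "complex^'a::finite^'b::finite"
    by (simp add: norm_vec_def[of C] L2_set_def sum_nonneg)
  have "(norm (A ** B))\<^sup>2 \<le> (\<Sum>i\<in>UNIV. \<Sum>j\<in>UNIV. (norm (A $ i))\<^sup>2 * (norm (ctrans B $ j))\<^sup>2)"
    unfolding norm_matrix_power2 power_mult_distrib[symmetric]
    by (intro sum_mono power_mono *) auto
  also have "\<dots> = (norm A)\<^sup>2 * (norm (ctrans B))\<^sup>2"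
    by (simp add: sq[of A] sq[of "ctrans B"] sum_product del: norm_ctrans)
  finally show ?thesis
    by (simp add: power_mult_distrib[symmetric] power2_le_iff_abs_le)
qed

text \<open>Induction on the index set, passing to the Schur complement of the diagonal entry at \<open>a\<close>.\<close>

lemma gram_decomposition_aux:
  fixes A :: "'n \<Rightarrow> 'n \<Rightarrow> complex"
  assumes "finite I"
    and "\<And>i j. i \<in> I \<Longrightarrow> j \<in> I \<Longrightarrow> A j i = cnj (A i j)"
    and "\<And>v. \<exists>i\<in>I. v i \<noteq> 0 \<Longrightarrow> Re (\<Sum>i\<in>I. \<Sum>j\<in>I. A i j * v i * cnj (v j)) > 0"
  shows "\<exists>T. \<forall>i\<in>I. \<forall>j\<in>I. A i j = (\<Sum>a\<in>I. T i a * cnj (T j a))"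
  using assms
proof (induction I arbitrary: A rule: finite_induct)
  case empty
  then show ?case by simp
next
  case (insert a I)
  note herm = insert.prems(1) and pos = insert.prems(2)
  define d where "d = Re (A a a)"
  have Aaa: "A a a = of_real d"
    using herm[of a a] by (simp add: d_def complex_eq_iff)
  have na: "\<And>j. j \<in> I \<Longrightarrow> (j = a) = False"
    using insert.hyps by auto
  have "Re (\<Sum>i\<in>insert a I. \<Sum>j\<in>insert a I. A i j * (if i = a then 1 else 0) * cnj (if j = a then 1 else 0)) > 0"
    by (rule pos) auto
  also have "(\<Sum>i\<in>insert a I. \<Sum>j\<in>insert a I. A i j * (if i = a then 1 else 0) * cnj (if j = a then 1 else 0))
      = A a a + (\<Sum>j\<in>I. 0) + (\<Sum>i\<in>I. 0 + (\<Sum>j\<in>I. 0))"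
    using insert.hyps na by (simp cong: sum.cong)
  finally have d: "d > 0" by (simp add: d_def)
  define A' where "A' i j = A i j - A i a * A a j / d" for i j
  have "\<exists>T. \<forall>i\<in>I. \<forall>j\<in>I. A' i j = (\<Sum>b\<in>I. T i b * cnj (T j b))"
  proof (rule insert.IH)
    fix i j assume "i \<in> I" "j \<in> I"
    then show "A' j i = cnj (A' i j)"
      using herm[of i j] herm[of i a] herm[of a j] by (simp add: A'_def)
  next
    fix v :: "'n \<Rightarrow> complex" assume v: "\<exists>i\<in>I. v i \<noteq> 0"
    define s where "s = (\<Sum>i\<in>I. A i a * v i)"
    \<comment> \<open>This value of the coordinate at \<open>a\<close> minimises the form of
      \<open>A\<close> for given \<open>v\<close> on \<open>I\<close>; with it, the form of
      \<open>A\<close> at \<open>w\<close> equals the form of \<open>A'\<close> at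
      \<open>v\<close>.\<close>
    define c where "c = - s / d"
    define w where "w = v(a := c)"
    have w: "w a = c" "i \<in> I \<Longrightarrow> w i = v i" for i
      using insert.hyps by (auto simp: w_def)
    have s': "(\<Sum>j\<in>I. A a j * cnj (v j)) = cnj s"
      unfolding s_def cnj_sum by (intro sum.cong) (auto simp: herm[of _ a])
    have "(\<Sum>i\<in>insert a I. \<Sum>j\<in>insert a I. A i j * w i * cnj (w j)) =
        d * c * cnj c + c * (\<Sum>j\<in>I. A a j * cnj (v j)) + (cnj c * s + (\<Sum>i\<in>I. \<Sum>j\<in>I. A i j * v i * cnj (v j)))"
      using insert.hyps w
      by (simp add: sum.distrib Aaa sum_distrib_left s_def mult_ac cong: sum.cong)
    also have "\<dots> = (\<Sum>i\<in>I. \<Sum>j\<in>I. A i j * v i * cnj (v j)) - s * cnj s / d"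
      unfolding s' c_def using d by (simp add: field_simps)
    also have "s * cnj s / d = (\<Sum>i\<in>I. \<Sum>j\<in>I. A i a * A a j / d * v i * cnj (v j))"
      unfolding s'[symmetric] unfolding s_def sum_product sum_divide_distrib
      by (intro sum.cong) (auto simp: mult_ac)
    also have "(\<Sum>i\<in>I. \<Sum>j\<in>I. A i j * v i * cnj (v j)) - \<dots> = (\<Sum>i\<in>I. \<Sum>j\<in>I. A' i j * v i * cnj (v j))"
      by (simp add: A'_def sum_subtractf algebra_simps)
    finally show "Re (\<Sum>i\<in>I. \<Sum>j\<in>I. A' i j * v i * cnj (v j)) > 0"
      using pos[of w] v w by (metis insertCI)
  qed
  then obtain T where T: "\<And>i j. i \<in> I \<Longrightarrow> j \<in> I \<Longrightarrow> A' i j = (\<Sum>b\<in>I. T i b * cnj (T j b))"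
    by blast
  \<comment> \<open>Column \<open>a\<close> carries the rank-one part split off from
    \<open>A\<close>; in the other columns row \<open>a\<close> is zero, so they contribute only to
    \<open>A'\<close>.\<close>
  define U where "U i b = (if b = a then A i a / sqrt d else if i = a then 0 else T i b)" for i b
  have Ub: "(\<Sum>b\<in>I. U i b * cnj (U j b)) = (if i = a \<or> j = a then 0 else A' i j)"
    if "i \<in> insert a I" "j \<in> insert a I" for i j
    using that insert.hyps by (auto simp: T U_def intro!: sum.neutral sum.cong)
  have sd: "complex_of_real (sqrt d) * of_real (sqrt d) = d"
    using d by (simp flip: of_real_mult)
  have "A i j = (\<Sum>b\<in>insert a I. U i b * cnj (U j b))" if "i \<in> insert a I" "j \<in> insert a I" for i j
  proof -
    have "(\<Sum>b\<in>insert a I. U i b * cnj (U j b)) = A i a * A a j / d + (if i = a \<or> j = a then 0 else A' i j)"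
      using insert.hyps that Ub herm[of j a] sd by (simp add: U_def)
    also have "\<dots> = A i j"
      using d by (auto simp: A'_def Aaa)
    finally show ?thesis ..
  qed
  then show ?case by blast
qed

lemma gram_decomposition:
  fixes A :: "complex^'n::finite^'n"
  assumes "hermitian_pos_def A"
  shows "\<exists>T::complex^'n^'n. A = T ** ctrans T"
proof -
  have "\<exists>T::'n \<Rightarrow> 'n \<Rightarrow> complex. \<forall>i\<in>UNIV. \<forall>j\<in>UNIV. A $ i $ j = (\<Sum>a\<in>UNIV. T i a * cnj (T j a))"
  proof (rule gram_decomposition_aux)
    fix v :: "'n \<Rightarrow> complex" assume "\<exists>i\<in>UNIV. v i \<noteq> 0"
    then have "vec_lambda v \<noteq> 0" by (auto simp: vec_eq_iff)
    then show "Re (\<Sum>i\<in>UNIV. \<Sum>j\<in>UNIV. A $ i $ j * v i * cnj (v j)) > 0"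
      using assms unfolding hermitian_pos_def_def by (metis (no_types, lifting) vec_lambda_beta sum.cong)
  next
    show "A $ j $ i = cnj (A $ i $ j)" for i j
      using assms unfolding hermitian_pos_def_def by blast
  qed simp
  then obtain T :: "'n \<Rightarrow> 'n \<Rightarrow> complex" where "\<And>i j. A $ i $ j = (\<Sum>a\<in>UNIV. T i a * cnj (T j a))" by blast
  then have "A = (\<chi> i j. T i j) ** ctrans (\<chi> i j. T i j)"
    by (simp add: vec_eq_iff matrix_matrix_mult_def)
  then show ?thesis by blast
qed

lemma hermitian_pos_def_imp_invertible:
  fixes A :: "complex^'n::finite^'n"
  assumes "hermitian_pos_def A"
  shows "invertible A"
proof -
  have "x = 0" if "A *v x = 0" for x
  proof (rule ccontr)
    assume "x \<noteq> 0"
    \<comment> \<open>The form pairs the row index with \<open>v\<close> and the column index with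
      \<open>cnj v\<close>; the conjugate of \<open>x\<close> turns it into the pairing of
      \<open>x\<close> with \<open>A *v x\<close>.\<close>
    then have "(\<chi> i. cnj (x $ i)) \<noteq> 0" by (simp add: vec_eq_iff)
    then have "Re (\<Sum>i\<in>UNIV. \<Sum>j\<in>UNIV. A $ i $ j * (\<chi> i. cnj (x $ i)) $ i * cnj ((\<chi> i. cnj (x $ i)) $ j)) > 0"
      using assms unfolding hermitian_pos_def_def by blast
    also have "(\<Sum>i\<in>UNIV. \<Sum>j\<in>UNIV. A $ i $ j * (\<chi> i. cnj (x $ i)) $ i * cnj ((\<chi> i. cnj (x $ i)) $ j))
        = (\<Sum>i\<in>UNIV. cnj (x $ i) * (A *v x) $ i)"
      by (simp add: matrix_vector_mult_def sum_distrib_left mult_ac)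
    finally show False by (simp add: that)
  qed
  then show ?thesis
    by (metis invertible_left_inverse matrix_left_invertible_ker)
qed

lemma matrix_inv_inverse:
  fixes A :: "complex^'n::finite^'n"
  assumes "invertible A"
  shows "A ** matrix_inv A = mat 1" and "matrix_inv A ** A = mat 1"
  using assms unfolding invertible_def matrix_inv_def by (metis (mono_tags, lifting) someI_ex)+

text \<open>\<open>S\<close> is the inverse of \<open>ctrans T\<close>, so a metric and its inverse
  are factored compatibly: \<open>S\<close> and \<open>T\<close> pass to a frame that is orthonormal
  for \<open>A\<close> and back.\<close>

lemma gram_inverse:
  fixes A :: "complex^'n::finite^'n"
  assumes "hermitian_pos_def A"
  obtains S T :: "complex^'n^'n" where "A = T ** ctrans T" "matrix_inv A = S ** ctrans S" "S ** ctrans T = mat 1"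
    "T ** ctrans S = mat 1"
proof -
  obtain T :: "complex^'n^'n" where T: "A = T ** ctrans T" using gram_decomposition[OF assms] by blast
  note inv = matrix_inv_inverse[OF hermitian_pos_def_imp_invertible[OF assms]]
  \<comment> \<open>Written through \<open>matrix_inv A\<close>, so that
    \<open>T ** ctrans S\<close> is literally \<open>A ** matrix_inv A\<close>.\<close>
  define S where "S = ctrans (ctrans T ** matrix_inv A)"
  have 1: "T ** ctrans S = mat 1" using inv(1) by (simp add: S_def T matrix_mul_assoc)
  have 2: "S ** ctrans T = mat 1" using 1 by (metis ctrans_ctrans ctrans_mat_1 ctrans_matrix_mult)
  have 3: "ctrans T ** S = mat 1" using 2 matrix_left_right_inverse by blast
  have "A ** (S ** ctrans S) = T ** (ctrans T ** S) ** ctrans S"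
    by (simp add: T matrix_mul_assoc)
  then have "A ** (S ** ctrans S) = mat 1" by (simp add: 1 3)
  then have "matrix_inv A = S ** ctrans S"
    by (metis inv(2) matrix_mul_assoc matrix_mul_lid matrix_mul_rid)
  with T 1 2 show thesis by (intro that)
qed

text \<open>In an orthonormal frame for the metric \<open>T ** ctrans T\<close> the pairing is the
  trace of \<open>X ** ctrans X\<close> against \<open>Y\<close>. Cauchy-Schwarz leaves the norm of
  \<open>X ** ctrans X\<close>, which submultiplicativity bounds by its trace; the norm of
  \<open>Y\<close> is the norm of \<open>R\<close> in that metric.\<close>

lemma psd_pairing_le:
  fixes C R S T :: "complex^'n::finite^'n"
  assumes inv: "S ** ctrans T = mat 1" "T ** ctrans S = mat 1" and herm: "ctrans R = R"
  shows "norm (trace (C ** ctrans C ** R)) \<le>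
    sqrt (Re (trace (S ** ctrans S ** R ** (S ** ctrans S) ** R))) * Re (trace (C ** ctrans C ** (T ** ctrans T)))"
proof -
  define X where "X = ctrans T ** C"
  define Y where "Y = ctrans S ** R ** S"
  have SX: "S ** X = C" and XS: "ctrans X ** ctrans S = ctrans C"
    using inv by (simp_all add: X_def matrix_mul_assoc ctrans_matrix_mult) (simp add: matrix_mul_assoc[symmetric])
  have Y: "ctrans Y = Y"
    by (simp add: Y_def ctrans_matrix_mult herm matrix_mul_assoc)
  have "trace (C ** ctrans C ** R) = trace (S ** (X ** ctrans X ** ctrans S ** R))"
    by (simp add: SX[symmetric] ctrans_matrix_mult matrix_mul_assoc)
  also have "\<dots> = trace ((X ** ctrans X) ** Y)"
    by (subst trace_mul_sym) (simp add: Y_def matrix_mul_assoc)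
  finally have eq: "trace (C ** ctrans C ** R) = trace ((X ** ctrans X) ** Y)" .
  have "trace (S ** ctrans S ** R ** (S ** ctrans S) ** R) = trace (S ** (ctrans S ** R ** S ** ctrans S ** R))"
    by (simp add: matrix_mul_assoc)
  also have "\<dots> = trace (Y ** ctrans Y)"
    by (subst trace_mul_sym) (subst Y, simp add: Y_def matrix_mul_assoc)
  finally have Y2: "sqrt (Re (trace (S ** ctrans S ** R ** (S ** ctrans S) ** R))) = norm Y"
    by (simp add: trace_mult_ctrans)
  have "trace (C ** ctrans C ** (T ** ctrans T)) = trace ((C ** ctrans C ** T) ** ctrans T)"
    by (simp add: matrix_mul_assoc)
  also have "\<dots> = trace (X ** ctrans X)"
    by (subst trace_mul_sym) (simp add: X_def ctrans_matrix_mult matrix_mul_assoc)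
  finally have X2: "Re (trace (C ** ctrans C ** (T ** ctrans T))) = norm X * norm X"
    by (simp add: trace_mult_ctrans power2_eq_square)
  have "norm (trace (C ** ctrans C ** R)) \<le> norm (X ** ctrans X) * norm Y"
    unfolding eq by (rule norm_trace_mult_le)
  also have "\<dots> \<le> (norm X * norm X) * norm Y"
    using norm_matrix_mult_le[of X "ctrans X"] by (intro mult_right_mono) auto
  finally show ?thesis
    unfolding X2 Y2 by (simp add: mult.commute)
qed

section \<open>Kronecker products, for metrics on pairs of indices\<close>

definition kron :: "complex^'n^'n \<Rightarrow> complex^'m^'m \<Rightarrow> complex^('n\<times>'m)^('n\<times>'m)" where
  "kron A B = (\<chi> p q. A $ fst p $ fst q * B $ snd p $ snd q)"

lemma sum_UNIV_prod:
  "(\<Sum>p\<in>(UNIV :: ('a::finite \<times> 'b::finite) set). h p) = (\<Sum>i\<in>UNIV. \<Sum>j\<in>UNIV. h (i, j))"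
  by (simp add: sum.cartesian_product UNIV_Times_UNIV[symmetric] del: UNIV_Times_UNIV)

lemma kron_nth [simp]: "kron A B $ (i, k) $ (j, l) = A $ i $ j * B $ k $ l"
  by (simp add: kron_def)

lemma kron_mult:
  fixes A C :: "complex^'n::finite^'n" and B D :: "complex^'m::finite^'m"
  shows "kron A B ** kron C D = kron (A ** C) (B ** D)"
  by (simp add: vec_eq_iff split_paired_all matrix_matrix_mult_def sum_UNIV_prod sum_product mult.assoc mult.left_commute)

lemma ctrans_kron: "ctrans (kron A B) = kron (ctrans A) (ctrans B)"
  by (simp add: vec_eq_iff split_paired_all)

lemma kron_mat_1: "kron (mat 1) (mat 1) = (mat 1 :: complex^('n::finite\<times>'m::finite)^('n\<times>'m))"
  by (auto simp: vec_eq_iff split_paired_all mat_def)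

lemma trace_kron:
  fixes A :: "complex^'n::finite^'n" and B :: "complex^'m::finite^'m"
  shows "trace (kron A B) = trace A * trace B"
  by (simp add: trace_def sum_UNIV_prod sum_product)

section \<open>The pointwise estimate\<close>

lemma trace_mult_eq_sum:
  fixes A :: "complex^'n::finite^'m::finite"
  shows "trace (A ** B) = (\<Sum>i\<in>UNIV. \<Sum>j\<in>UNIV. A $ i $ j * B $ j $ i)"
  by (simp add: trace_def matrix_matrix_mult_def)

text \<open>With \<open>t\<close> read as a column vector, both sides are the squared length of
  \<open>ctrans V *v t\<close>.\<close>

lemma gram_form_eq:
  fixes V :: "complex^'n::finite^'n"
  shows "(\<Sum>k\<in>UNIV. \<Sum>l\<in>UNIV. (V ** ctrans V) $ l $ k * (t k * cnj (t l)))
    = of_real (\<Sum>a\<in>UNIV. (norm (\<Sum>k\<in>UNIV. cnj (V $ k $ a) * t k))\<^sup>2)"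
proof -
  have "(\<Sum>k\<in>UNIV. \<Sum>l\<in>UNIV. (V ** ctrans V) $ l $ k * (t k * cnj (t l)))
    = (\<Sum>k\<in>UNIV. \<Sum>l\<in>UNIV. \<Sum>a\<in>UNIV. (cnj (V $ k $ a) * t k) * (V $ l $ a * cnj (t l)))"
    by (simp add: matrix_matrix_mult_def sum_distrib_left sum_distrib_right mult_ac)
  also have "\<dots> = (\<Sum>k\<in>UNIV. \<Sum>a\<in>UNIV. \<Sum>l\<in>UNIV. (cnj (V $ k $ a) * t k) * (V $ l $ a * cnj (t l)))"
    by (intro sum.cong refl sum.swap)
  also have "\<dots> = (\<Sum>a\<in>UNIV. \<Sum>k\<in>UNIV. \<Sum>l\<in>UNIV. (cnj (V $ k $ a) * t k) * (V $ l $ a * cnj (t l)))"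
    by (rule sum.swap)
  also have "\<dots> = (\<Sum>a\<in>UNIV. (\<Sum>k\<in>UNIV. cnj (V $ k $ a) * t k) * cnj (\<Sum>k\<in>UNIV. cnj (V $ k $ a) * t k))"
    by (simp add: sum_product)
  also have "\<dots> = of_real (\<Sum>a\<in>UNIV. (norm (\<Sum>k\<in>UNIV. cnj (V $ k $ a) * t k))\<^sup>2)"
    by (simp only: of_real_sum complex_norm_square)
  finally show ?thesis .
qed

text \<open>The combinations \<open>W a\<close> of the \<open>Y k\<close> diagonalise the form given
  by \<open>V ** ctrans V\<close>. Both sides become sums over \<open>a\<close>, and the inequality
  holds term by term by Cauchy-Schwarz for the trace of \<open>W a ** Z\<close>.\<close>

lemma gram_form_trace_cauchy_schwarz:
  fixes V :: "complex^'n::finite^'n" and Y :: "'n \<Rightarrow> complex^'q::finite^'p::finite"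
  shows "Re (\<Sum>k\<in>UNIV. \<Sum>l\<in>UNIV. (V ** ctrans V) $ l $ k * (trace (Y k ** Z) * cnj (trace (Y l ** Z))))
    \<le> (norm Z)\<^sup>2 * Re (\<Sum>k\<in>UNIV. \<Sum>l\<in>UNIV. (V ** ctrans V) $ l $ k * trace (Y k ** ctrans (Y l)))"
proof -
  define W where "W a = (\<chi> i j. \<Sum>k\<in>UNIV. cnj (V $ k $ a) * Y k $ i $ j)" for a
  have "trace (W a ** Z) = (\<Sum>k\<in>UNIV. cnj (V $ k $ a) * trace (Y k ** Z))" for a
  proof -
    have "trace (W a ** Z) = (\<Sum>i\<in>UNIV. \<Sum>j\<in>UNIV. \<Sum>k\<in>UNIV. cnj (V $ k $ a) * (Y k $ i $ j * Z $ j $ i))"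
      by (simp add: trace_mult_eq_sum W_def sum_distrib_right mult.assoc)
    also have "\<dots> = (\<Sum>i\<in>UNIV. \<Sum>k\<in>UNIV. \<Sum>j\<in>UNIV. cnj (V $ k $ a) * (Y k $ i $ j * Z $ j $ i))"
      by (intro sum.cong refl sum.swap)
    also have "\<dots> = (\<Sum>k\<in>UNIV. \<Sum>i\<in>UNIV. \<Sum>j\<in>UNIV. cnj (V $ k $ a) * (Y k $ i $ j * Z $ j $ i))"
      by (rule sum.swap)
    finally show ?thesis
      by (simp add: trace_mult_eq_sum sum_distrib_left)
  qed
  then have lhs: "(\<Sum>k\<in>UNIV. \<Sum>l\<in>UNIV. (V ** ctrans V) $ l $ k * (trace (Y k ** Z) * cnj (trace (Y l ** Z))))
      = of_real (\<Sum>a\<in>UNIV. (norm (trace (W a ** Z)))\<^sup>2)"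
    by (simp add: gram_form_eq)
  have "(\<Sum>k\<in>UNIV. \<Sum>l\<in>UNIV. (V ** ctrans V) $ l $ k * trace (Y k ** ctrans (Y l)))
      = (\<Sum>k\<in>UNIV. \<Sum>l\<in>UNIV. \<Sum>p\<in>UNIV. (V ** ctrans V) $ l $ k * (Y k $ fst p $ snd p * cnj (Y l $ fst p $ snd p)))"
    by (simp add: trace_mult_eq_sum sum_distrib_left sum_UNIV_prod)
  also have "\<dots> = (\<Sum>k\<in>UNIV. \<Sum>p\<in>UNIV. \<Sum>l\<in>UNIV. (V ** ctrans V) $ l $ k * (Y k $ fst p $ snd p * cnj (Y l $ fst p $ snd p)))"
    by (intro sum.cong refl sum.swap)
  also have "\<dots> = (\<Sum>p\<in>UNIV. \<Sum>k\<in>UNIV. \<Sum>l\<in>UNIV. (V ** ctrans V) $ l $ k * (Y k $ fst p $ snd p * cnj (Y l $ fst p $ snd p)))"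
    by (rule sum.swap)
  also have "\<dots> = of_real (\<Sum>p\<in>UNIV. \<Sum>a\<in>UNIV. (norm (W a $ fst p $ snd p))\<^sup>2)"
    by (simp add: gram_form_eq W_def)
  also have "(\<Sum>p\<in>UNIV. \<Sum>a\<in>UNIV. (norm (W a $ fst p $ snd p))\<^sup>2) = (\<Sum>a\<in>UNIV. (norm (W a))\<^sup>2)"
    by (subst sum.swap) (simp add: norm_matrix_power2 sum_UNIV_prod)
  finally have rhs: "Re (\<Sum>k\<in>UNIV. \<Sum>l\<in>UNIV. (V ** ctrans V) $ l $ k * trace (Y k ** ctrans (Y l)))
      = (\<Sum>a\<in>UNIV. (norm (W a))\<^sup>2)"
    by (simp only: Re_complex_of_real)
  have "(norm (trace (W a ** Z)))\<^sup>2 \<le> (norm Z)\<^sup>2 * (norm (W a))\<^sup>2" for a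
    unfolding power_mult_distrib[symmetric]
    using norm_trace_mult_le[of "W a" Z] by (intro power_mono) (simp_all add: mult.commute)
  then show ?thesis
    unfolding lhs rhs sum_distrib_left Re_complex_of_real by (intro sum_mono)
qed

lemma trace_kron_mult_eq_sum:
  fixes P :: "complex^'n::finite^'n" and R :: "complex^('n\<times>'n)^('n\<times>'n)"
  shows "trace (kron P P ** R) =
    (\<Sum>k\<in>UNIV. \<Sum>l\<in>UNIV. P $ l $ k * (\<Sum>j\<in>UNIV. \<Sum>i\<in>UNIV. P $ j $ i * R $ (i, k) $ (j, l)))"
proof -
  have "trace (kron P P ** R) = (\<Sum>j\<in>UNIV. \<Sum>l\<in>UNIV. \<Sum>i\<in>UNIV. \<Sum>k\<in>UNIV. P $ l $ k * (P $ j $ i * R $ (i, k) $ (j, l)))"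
    by (simp add: trace_mult_eq_sum sum_UNIV_prod mult_ac)
  also have "\<dots> = (\<Sum>l\<in>UNIV. \<Sum>j\<in>UNIV. \<Sum>i\<in>UNIV. \<Sum>k\<in>UNIV. P $ l $ k * (P $ j $ i * R $ (i, k) $ (j, l)))"
    by (rule sum.swap)
  also have "\<dots> = (\<Sum>l\<in>UNIV. \<Sum>j\<in>UNIV. \<Sum>k\<in>UNIV. \<Sum>i\<in>UNIV. P $ l $ k * (P $ j $ i * R $ (i, k) $ (j, l)))"
    by (intro sum.cong refl sum.swap)
  also have "\<dots> = (\<Sum>l\<in>UNIV. \<Sum>k\<in>UNIV. \<Sum>j\<in>UNIV. \<Sum>i\<in>UNIV. P $ l $ k * (P $ j $ i * R $ (i, k) $ (j, l)))"
    by (intro sum.cong refl sum.swap)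
  also have "\<dots> = (\<Sum>k\<in>UNIV. \<Sum>l\<in>UNIV. \<Sum>j\<in>UNIV. \<Sum>i\<in>UNIV. P $ l $ k * (P $ j $ i * R $ (i, k) $ (j, l)))"
    by (rule sum.swap)
  finally show ?thesis
    by (simp add: sum_distrib_left)
qed

lemma sum_contract_trace:
  fixes P N :: "complex^'n::finite^'n"
  shows "(\<Sum>k\<in>UNIV. \<Sum>l\<in>UNIV. P $ l $ k * trace (X k l ** N))
    = trace ((\<chi> i j. \<Sum>k\<in>UNIV. \<Sum>l\<in>UNIV. P $ l $ k * X k l $ i $ j) ** N)"
proof -
  have "(\<Sum>k\<in>UNIV. \<Sum>l\<in>UNIV. P $ l $ k * trace (X k l ** N))
    = (\<Sum>q\<in>UNIV. \<Sum>p\<in>UNIV. P $ snd q $ fst q * X (fst q) (snd q) $ fst p $ snd p * N $ snd p $ fst p)"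
    by (simp add: trace_mult_eq_sum sum_UNIV_prod sum_distrib_left mult.assoc)
  also have "\<dots> = (\<Sum>p\<in>UNIV. \<Sum>q\<in>UNIV. P $ snd q $ fst q * X (fst q) (snd q) $ fst p $ snd p * N $ snd p $ fst p)"
    by (rule sum.swap)
  finally show ?thesis
    by (simp add: trace_mult_eq_sum sum_UNIV_prod sum_distrib_right)
qed

lemma trace_gram_mult:
  fixes V T :: "complex^'n::finite^'n"
  shows "trace ((V ** ctrans V) ** (T ** ctrans T)) = of_real ((norm (ctrans T ** V))\<^sup>2)"
proof -
  have "trace ((V ** ctrans V) ** (T ** ctrans T)) = trace (V ** (ctrans V ** T ** ctrans T))"
    by (simp add: matrix_mul_assoc)
  also have "\<dots> = trace (ctrans (ctrans T ** V) ** ctrans (ctrans (ctrans T ** V)))"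
    by (subst trace_mul_sym) (simp add: ctrans_matrix_mult matrix_mul_assoc)
  finally show ?thesis
    by (simp only: trace_mult_ctrans norm_ctrans)
qed

lemma
  fixes F G :: "complex^'n::finite^'n"
  assumes F: "hermitian_pos_def F" and G: "hermitian_pos_def G"
  shows trace_matrix_inv_mult_real: "Im (trace (matrix_inv F ** G)) = 0"
    and trace_matrix_inv_mult_pos: "Re (trace (matrix_inv F ** G)) > 0"
proof -
  obtain V U :: "complex^'n^'n" where PV: "matrix_inv F = V ** ctrans V" and VU: "V ** ctrans U = mat 1"
    by (rule gram_inverse[OF F])
  obtain S T :: "complex^'n^'n" where GT: "G = T ** ctrans T" and ST: "S ** ctrans T = mat 1"
    by (rule gram_inverse[OF G])
  have tr: "trace (matrix_inv F ** G) = of_real ((norm (ctrans T ** V))\<^sup>2)"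
    unfolding PV GT by (rule trace_gram_mult)
  \<comment> \<open>The factor whose norm appears in \<open>tr\<close> can be multiplied to the
    identity, which is nonzero because an index type is nonempty; so the factor itself is
    nonzero.\<close>
  have "S ** (ctrans T ** V) ** ctrans U = mat 1"
    by (simp add: ST VU matrix_mul_assoc)
  moreover have "(mat 1 :: complex^'n^'n) \<noteq> 0"
    by (simp add: vec_eq_iff mat_def)
  ultimately have "ctrans T ** V \<noteq> 0"
    by auto
  with tr show "Im (trace (matrix_inv F ** G)) = 0" "Re (trace (matrix_inv F ** G)) > 0"
    by simp_all
qed

text \<open>This is the negative complex Hessian of the logarithm of the determinant, expanded by
  Jacobi's formula and the derivative of the inverse: \<open>F1 i\<close> stands for the derivative
  of the metric in \<open>z\<^sub>i\<close>, \<open>ctrans (F1 j)\<close> for the one in the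
  conjugate of \<open>z\<^sub>j\<close>, and \<open>F2 i j\<close> for the mixed one.\<close>

definition ricci_matrix ::
  "complex^'n::finite^'n \<Rightarrow> ('n \<Rightarrow> complex^'n^'n) \<Rightarrow> ('n \<Rightarrow> 'n \<Rightarrow> complex^'n^'n) \<Rightarrow> complex^'n^'n" where
  "ricci_matrix P F1 F2 = (\<chi> i j. trace (P ** F1 i ** P ** ctrans (F1 j)) - trace (P ** F2 i j))"

text \<open>
  The curvature tensor becomes a hermitian matrix over pairs of indices: the unbarred indices
  \<open>(i, k)\<close> number the rows, the barred ones \<open>(j, l)\<close> the columns. The metric on such pairs is a
  Kronecker square.
\<close>

definition curvature_matrix ::
  "complex^'n::finite^'n \<Rightarrow> ('n \<Rightarrow> complex^'n^'n) \<Rightarrow> ('n \<Rightarrow> 'n \<Rightarrow> complex^'n^'n) \<Rightarrow> complex^('n\<times>'n)^('n\<times>'n)" where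
  "curvature_matrix Q G1 G2 = (\<chi> p q. (G1 (snd p) ** Q ** ctrans (G1 (snd q)) - G2 (snd p) (snd q)) $ fst p $ fst q)"

text \<open>The derivatives at one point enter as free matrices, which leaves pure linear algebra.
  \<open>u1\<close> and \<open>u2\<close> are the first and mixed second derivatives of
  \<open>u\<close> as the product rule gives them, and the sum in the conclusion is the Laplacian of
  \<open>ln u\<close>, with \<open>P\<close> transposed as in \<open>inv_metric\<close>. That
  \<open>F\<close> is a complex Hessian survives only as the symmetries \<open>sym1\<close> and
  \<open>sym2\<close>.\<close>

lemma laplacian_log_trace_estimate:
  fixes F G :: "complex^'n::finite^'n" and F1 G1 :: "'n \<Rightarrow> complex^'n^'n" and F2 G2 :: "'n \<Rightarrow> 'n \<Rightarrow> complex^'n^'n"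
  assumes F: "hermitian_pos_def F" and G: "hermitian_pos_def G"
    and hF2: "\<And>k l. ctrans (F2 k l) = F2 l k" and hG2: "\<And>k l. ctrans (G2 k l) = G2 l k"
    and sym1: "\<And>i j k. F1 k $ i $ j = F1 i $ k $ j" and sym2: "\<And>i j k l. F2 k l $ i $ j = F2 i j $ k $ l"
  defines "P \<equiv> matrix_inv F" and "Q \<equiv> matrix_inv G"
  defines "u \<equiv> Re (trace (P ** G))"
  defines "u1 \<equiv> \<lambda>k. trace (P ** G1 k) - trace (P ** F1 k ** P ** G)"
  defines "u2 \<equiv> \<lambda>k l. trace (P ** G2 k l) - trace (P ** F1 k ** P ** ctrans (G1 l))
      - trace (P ** ctrans (F1 l) ** P ** G1 k) + trace (P ** F1 k ** P ** ctrans (F1 l) ** P ** G)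
      + trace (P ** ctrans (F1 l) ** P ** F1 k ** P ** G) - trace (P ** F2 k l ** P ** G)"
  defines "Ric \<equiv> ricci_matrix P F1 F2" and "R \<equiv> curvature_matrix Q G1 G2"
  shows "Re (\<Sum>k\<in>UNIV. \<Sum>l\<in>UNIV. P $ l $ k * (u2 k l / of_real u - u1 k * cnj (u1 l) / (of_real u)\<^sup>2))
      \<ge> - sqrt (Re (trace (P ** Ric ** P ** Ric))) - sqrt (Re (trace (kron Q Q ** R ** kron Q Q ** R))) * u"
proof -
  obtain V U :: "complex^'n^'n" where FU: "F = U ** ctrans U" and PV: "P = V ** ctrans V" and VU: "V ** ctrans U = mat 1" "U ** ctrans V = mat 1"
    by (rule gram_inverse[OF F, folded P_def]) blast
  obtain S T :: "complex^'n^'n" where GT: "G = T ** ctrans T" and QS: "Q = S ** ctrans S" and ST: "S ** ctrans T = mat 1" "T ** ctrans S = mat 1"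
    by (rule gram_inverse[OF G, folded Q_def]) blast
  have PF: "P ** F = mat 1" and QG: "G ** Q = mat 1" "Q ** G = mat 1"
    unfolding P_def Q_def by (simp_all add: matrix_inv_inverse hermitian_pos_def_imp_invertible F G)
  have hP: "ctrans P = P" and hG: "ctrans G = G" and hQ: "ctrans Q = Q"
    by (simp_all add: PV GT QS ctrans_matrix_mult)
  have cancel: "M ** P ** F = M" "M ** G ** Q = M" "M ** Q ** G = M" for M :: "complex^'n^'n"
    by (simp_all add: PF QG flip: matrix_mul_assoc)
  \<comment> \<open>The transition matrix between orthonormal frames of the two metrics;
    \<open>u\<close> is its squared norm.\<close>
  define Z where "Z = ctrans T ** V"
  have tr: "trace (P ** G) = of_real ((norm Z)\<^sup>2)"
    unfolding PV GT Z_def by (rule trace_gram_mult)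
  then have u: "u = (norm Z)\<^sup>2" and tr: "trace (P ** G) = of_real u"
    by (simp_all add: u_def)
  have "u > 0"
    unfolding u_def P_def by (rule trace_matrix_inv_mult_pos[OF F G])

  \<comment> \<open>\<open>X k l\<close> is the curvature of the metric \<open>F\<close> in the
    directions \<open>k\<close> and \<open>l\<close>. \<open>A k\<close> completes the square in
    \<open>G1\<close>: the cross terms give the mixed terms of \<open>u2\<close>, and the term
    quadratic in \<open>G1\<close> is compensated by the curvature matrix \<open>R\<close> of
    \<open>G\<close>.\<close>
  define X where "X k l = F1 k ** P ** ctrans (F1 l) - F2 k l" for k l
  define A where "A k = G1 k - F1 k ** P ** G" for k
  have u2: "u2 k l = trace (X k l ** (P ** G ** P)) - (\<Sum>j\<in>UNIV. \<Sum>i\<in>UNIV. P $ j $ i * R $ (i, k) $ (j, l))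
      + trace (P ** A k ** Q ** ctrans (A l))" for k l
  proof -
    have 1: "trace (X k l ** (P ** G ** P)) = trace (P ** F1 k ** P ** ctrans (F1 l) ** P ** G) - trace (P ** F2 k l ** P ** G)"
      by (subst matrix_mul_assoc, subst trace_mul_sym)
        (simp add: X_def matrix_diff_ldistrib matrix_diff_rdistrib trace_sub matrix_mul_assoc)
    have 2: "(\<Sum>j\<in>UNIV. \<Sum>i\<in>UNIV. P $ j $ i * R $ (i, k) $ (j, l))
        = trace (P ** G1 k ** Q ** ctrans (G1 l)) - trace (P ** G2 k l)"
    proof -
      have "(\<Sum>j\<in>UNIV. \<Sum>i\<in>UNIV. P $ j $ i * R $ (i, k) $ (j, l)) = trace (P ** (G1 k ** Q ** ctrans (G1 l) - G2 k l))"
        by (simp add: trace_mult_eq_sum R_def curvature_matrix_def)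
      then show ?thesis
        by (simp add: matrix_diff_ldistrib trace_sub matrix_mul_assoc)
    qed
    have 3: "trace (P ** A k ** Q ** ctrans (A l)) = trace (P ** G1 k ** Q ** ctrans (G1 l))
        - trace (P ** G1 k ** P ** ctrans (F1 l)) - trace (P ** F1 k ** P ** ctrans (G1 l))
        + trace (P ** F1 k ** P ** G ** P ** ctrans (F1 l))"
    proof -
      have "ctrans (A l) = ctrans (G1 l) - G ** P ** ctrans (F1 l)"
        by (simp add: A_def ctrans_matrix_mult hP hG matrix_mul_assoc[symmetric] ctrans_diff)
      then show ?thesis
        by (simp add: A_def matrix_diff_ldistrib matrix_diff_rdistrib trace_sub matrix_mul_assoc cancel)
    qed
    have 4: "trace (P ** G1 k ** P ** ctrans (F1 l)) = trace (P ** ctrans (F1 l) ** P ** G1 k)"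
      using trace_mul_sym[of "P ** G1 k" "P ** ctrans (F1 l)"] by (simp add: matrix_mul_assoc)
    have 5: "trace (P ** F1 k ** P ** G ** P ** ctrans (F1 l)) = trace (P ** ctrans (F1 l) ** P ** F1 k ** P ** G)"
      using trace_mul_sym[of "P ** F1 k ** P ** G" "P ** ctrans (F1 l)"] by (simp add: matrix_mul_assoc)
    show ?thesis
      unfolding u2_def 1 2 3 4 5 by (simp add: algebra_simps)
  qed
  \<comment> \<open>The contractions with \<open>P\<close>: \<open>S1\<close> is the Ricci part,
    \<open>S2\<close> the curvature part, \<open>S3\<close> the squared norm of \<open>A\<close>,
    and \<open>S4\<close> the squared gradient of \<open>u\<close>.\<close>
  define S1 where "S1 = (\<Sum>k\<in>UNIV. \<Sum>l\<in>UNIV. P $ l $ k * trace (X k l ** (P ** G ** P)))"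
  define S2 where "S2 = (\<Sum>k\<in>UNIV. \<Sum>l\<in>UNIV. P $ l $ k * (\<Sum>j\<in>UNIV. \<Sum>i\<in>UNIV. P $ j $ i * R $ (i, k) $ (j, l)))"
  define S3 where "S3 = (\<Sum>k\<in>UNIV. \<Sum>l\<in>UNIV. P $ l $ k * trace (P ** A k ** Q ** ctrans (A l)))"
  define S4 where "S4 = (\<Sum>k\<in>UNIV. \<Sum>l\<in>UNIV. P $ l $ k * (u1 k * cnj (u1 l)))"
  have sum_eq: "(\<Sum>k\<in>UNIV. \<Sum>l\<in>UNIV. P $ l $ k * (u2 k l / of_real u - u1 k * cnj (u1 l) / (of_real u)\<^sup>2))
      = (S1 - S2 + S3) / of_real u - S4 / of_real (u\<^sup>2)"
  proof -
    define C where "C k l = (\<Sum>j\<in>UNIV. \<Sum>i\<in>UNIV. P $ j $ i * R $ (i, k) $ (j, l))" for k l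
    have "P $ l $ k * (u2 k l / of_real u - u1 k * cnj (u1 l) / (of_real u)\<^sup>2)
      = (P $ l $ k * trace (X k l ** (P ** G ** P)) - P $ l $ k * C k l
          + P $ l $ k * trace (P ** A k ** Q ** ctrans (A l))) / of_real u
        - P $ l $ k * (u1 k * cnj (u1 l)) / of_real (u\<^sup>2)" for k l
      unfolding u2 C_def[symmetric] by (simp add: ring_distribs add_divide_distrib diff_divide_distrib)
    then show ?thesis
      by (simp only: S1_def S2_def S3_def S4_def C_def sum.distrib sum_subtractf flip: sum_divide_distrib)
  qed

  have S1_bound: "norm S1 \<le> sqrt (Re (trace (P ** Ric ** P ** Ric))) * u"
  proof -
    have sym1': "ctrans (F1 k) $ i $ j = ctrans (F1 j) $ i $ k" for i j k
      using sym1[of k j i] by simp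
    \<comment> \<open>By the symmetries of the derivatives of \<open>f\<close>, the pairs \<open>(k, l)\<close> and \<open>(i, j)\<close> may be exchanged.\<close>
    have "(\<Sum>k\<in>UNIV. \<Sum>l\<in>UNIV. P $ l $ k * X k l $ i $ j) = Ric $ i $ j" for i j
    proof -
      have "X k l $ i $ j = X i j $ k $ l" for k l
        by (simp add: X_def sym2[of k l] matrix_matrix_mult_def sum_distrib_right sym1[of k i] sym1'[of l _ j] del: ctrans_nth)
      then have "(\<Sum>k\<in>UNIV. \<Sum>l\<in>UNIV. P $ l $ k * X k l $ i $ j) = (\<Sum>l\<in>UNIV. \<Sum>k\<in>UNIV. P $ l $ k * X i j $ k $ l)"
        by (subst sum.swap) simp
      also have "\<dots> = trace (P ** X i j)"
        by (simp add: trace_mult_eq_sum)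
      finally show ?thesis
        by (simp add: Ric_def ricci_matrix_def X_def matrix_diff_ldistrib trace_sub matrix_mul_assoc)
    qed
    then have "(\<chi> i j. \<Sum>k\<in>UNIV. \<Sum>l\<in>UNIV. P $ l $ k * X k l $ i $ j) = Ric"
      by (simp add: vec_eq_iff)
    then have "S1 = trace (Ric ** (P ** G ** P))"
      unfolding S1_def sum_contract_trace by simp
    also have "\<dots> = trace ((P ** T) ** ctrans (P ** T) ** Ric)"
      by (subst trace_mul_sym) (simp add: GT ctrans_matrix_mult hP matrix_mul_assoc)
    finally have S1: "S1 = trace ((P ** T) ** ctrans (P ** T) ** Ric)" .
    have "ctrans Ric = Ric"
    proof -
      have "cnj (Ric $ j $ i) = Ric $ i $ j" for i j
      proof -
        have "cnj (trace (P ** F1 j ** P ** ctrans (F1 i))) = trace (F1 i ** (P ** ctrans (F1 j) ** P))"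
          unfolding trace_ctrans[symmetric] by (simp add: ctrans_matrix_mult hP matrix_mul_assoc)
        also have "\<dots> = trace (P ** F1 i ** P ** ctrans (F1 j))"
          using trace_mul_sym[of "F1 i ** P ** ctrans (F1 j)" P] by (simp add: matrix_mul_assoc)
        finally have "cnj (trace (P ** F1 j ** P ** ctrans (F1 i))) = trace (P ** F1 i ** P ** ctrans (F1 j))" .
        moreover have "cnj (trace (P ** F2 j i)) = trace (P ** F2 i j)"
          unfolding trace_ctrans[symmetric] ctrans_matrix_mult hP hF2 by (rule trace_mul_sym)
        ultimately show ?thesis
          by (simp add: Ric_def ricci_matrix_def)
      qed
      then show ?thesis by (simp add: vec_eq_iff)
    qed
    \<comment> \<open>The metric is \<open>F\<close>, and \<open>P ** T\<close> is a Gram factor of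
      \<open>P ** G ** P\<close>; the trace in the bound is that of \<open>P ** G ** P ** F\<close>,
      hence \<open>u\<close>.\<close>
    from psd_pairing_le[OF VU this, of "P ** T"]
    have "norm S1 \<le> sqrt (Re (trace (P ** Ric ** P ** Ric))) * Re (trace (P ** T ** ctrans (P ** T) ** F))"
      by (simp add: S1 PV[symmetric] FU[symmetric])
    also have "P ** T ** ctrans (P ** T) ** F = P ** G"
      by (simp add: ctrans_matrix_mult hP matrix_mul_assoc cancel GT)
    finally show ?thesis by (simp add: tr)
  qed

  have S2_bound: "norm S2 \<le> sqrt (Re (trace (kron Q Q ** R ** kron Q Q ** R))) * u\<^sup>2"
  proof -
    have S2: "S2 = trace (kron P P ** R)"
      by (simp add: S2_def trace_kron_mult_eq_sum)
    have "cnj (R $ (j, l) $ (i, k)) = R $ (i, k) $ (j, l)" for i j k l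
    proof -
      let ?M = "\<lambda>k l. G1 k ** Q ** ctrans (G1 l) - G2 k l"
      have "ctrans (?M l k) = ?M k l"
        by (simp add: ctrans_diff ctrans_matrix_mult hQ hG2 matrix_mul_assoc)
      then have "ctrans (?M l k) $ i $ j = ?M k l $ i $ j" by simp
      then show ?thesis by (simp add: R_def curvature_matrix_def)
    qed
    then have hR: "ctrans R = R"
      by (simp add: vec_eq_iff split_paired_all)
    have inv: "kron S S ** ctrans (kron T T) = mat 1" "kron T T ** ctrans (kron S S) = mat 1"
      by (simp_all add: ctrans_kron kron_mult ST kron_mat_1)
    \<comment> \<open>Now the metric is \<open>kron G G\<close> and the paired matrix is
      \<open>kron P P\<close>. The trace in the bound is the square of \<open>u\<close>, which after
      division by \<open>u\<close> leaves the factor \<open>u\<close> next to the curvature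
      norm.\<close>
    from psd_pairing_le[OF inv hR, of "kron V V"]
    have "norm S2 \<le> sqrt (Re (trace (kron Q Q ** R ** kron Q Q ** R))) * Re (trace (kron P P ** kron G G))"
      by (simp add: S2 ctrans_kron kron_mult PV[symmetric] QS[symmetric] GT[symmetric])
    also have "trace (kron P P ** kron G G) = of_real (u\<^sup>2)"
      by (simp add: kron_mult trace_kron tr power2_eq_square)
    finally show ?thesis by simp
  qed

  have S4_bound: "Re S4 \<le> u * Re S3"
  proof -
    \<comment> \<open>\<open>A k\<close> in frames adapted to \<open>F\<close> on the left and to
      \<open>G\<close> on the right: its squared norm in both metrics becomes the Frobenius norm,
      and \<open>u1 k\<close> becomes the pairing with \<open>Z\<close>. Since \<open>Z\<close> has
      squared norm \<open>u\<close>, Cauchy-Schwarz yields the factor \<open>u\<close>.\<close>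
    define Y where "Y k = ctrans V ** A k ** S" for k
    have u1: "u1 k = trace (Y k ** Z)" for k
    proof -
      have "u1 k = trace (P ** A k)"
        by (simp add: A_def u1_def matrix_diff_ldistrib trace_sub matrix_mul_assoc)
      also have "\<dots> = trace (V ** (ctrans V ** A k ** (S ** ctrans T)))"
        by (simp add: PV ST matrix_mul_assoc)
      also have "\<dots> = trace (Y k ** Z)"
        by (subst trace_mul_sym) (simp add: Y_def Z_def matrix_mul_assoc)
      finally show ?thesis .
    qed
    have Y: "trace (P ** A k ** Q ** ctrans (A l)) = trace (Y k ** ctrans (Y l))" for k l
    proof -
      have "trace (P ** A k ** Q ** ctrans (A l)) = trace (V ** (ctrans V ** A k ** S ** ctrans S ** ctrans (A l)))"
        by (simp add: PV QS matrix_mul_assoc)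
      also have "\<dots> = trace (Y k ** ctrans (Y l))"
        by (subst trace_mul_sym) (simp add: Y_def ctrans_matrix_mult matrix_mul_assoc)
      finally show ?thesis .
    qed
    show ?thesis
      using gram_form_trace_cauchy_schwarz[of V Y Z, folded PV] unfolding S3_def S4_def u1 Y u .
  qed

  let ?a = "sqrt (Re (trace (P ** Ric ** P ** Ric)))" and ?b = "sqrt (Re (trace (kron Q Q ** R ** kron Q Q ** R)))"
  have "(- ?a - ?b * u) * u = - (?a * u) - ?b * u\<^sup>2"
    by (simp add: algebra_simps power2_eq_square)
  also have "\<dots> \<le> Re S1 - Re S2"
    using S1_bound S2_bound abs_Re_le_cmod[of S1] abs_Re_le_cmod[of S2] by linarith
  finally have "- ?a - ?b * u \<le> (Re S1 - Re S2) / u"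
    using \<open>u > 0\<close> by (simp add: pos_le_divide_eq)
  moreover have "Re S4 / u\<^sup>2 \<le> Re S3 / u"
    using S4_bound \<open>u > 0\<close> by (simp add: power2_eq_square field_simps)
  moreover have "Re ((S1 - S2 + S3) / of_real u - S4 / of_real (u\<^sup>2)) = (Re S1 - Re S2) / u + Re S3 / u - Re S4 / u\<^sup>2"
    by (simp only: Re_divide_of_real minus_complex.simps plus_complex.simps add_divide_distrib)
  ultimately show "Re (\<Sum>k\<in>UNIV. \<Sum>l\<in>UNIV. P $ l $ k * (u2 k l / of_real u - u1 k * cnj (u1 l) / (of_real u)\<^sup>2))
      \<ge> - ?a - ?b * u"
    unfolding sum_eq by linarith
qed

section \<open>Wirtinger derivatives\<close>

text \<open>\<open>frechet_derivative\<close> is a choice from the predicate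
  \<open>has_derivative\<close>, and that predicate is local; so the equality also holds where no
  derivative exists.\<close>

lemma frechet_derivative_cong_open:
  assumes "open S" "x \<in> S" "\<And>y. y \<in> S \<Longrightarrow> F y = G y"
  shows "frechet_derivative F (at x) = frechet_derivative G (at x)"
proof -
  have "(F has_derivative D) (at x) \<longleftrightarrow> (G has_derivative D) (at x)" for D
    using assms by (metis has_derivative_transform_within_open)
  then show ?thesis
    by (simp add: frechet_derivative_def)
qed

lemma differentiable_cong_open:
  assumes "open S" "x \<in> S" "\<And>y. y \<in> S \<Longrightarrow> F y = G y"
  shows "F differentiable (at x) \<longleftrightarrow> G differentiable (at x)"
  using assms unfolding differentiable_def by (metis has_derivative_transform_within_open)

lemma C_k_on_cong:
  assumes "open S" "\<And>y. y \<in> S \<Longrightarrow> F y = G y"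
  shows "C_k_on k F S \<longleftrightarrow> C_k_on k G S"
  using assms(2)
proof (induction k arbitrary: F G)
  case 0
  then show ?case by (simp cong: continuous_on_cong)
next
  case (Suc k)
  have "C_k_on k (\<lambda>x. frechet_derivative F (at x) v) S \<longleftrightarrow> C_k_on k (\<lambda>x. frechet_derivative G (at x) v) S" for v
    by (rule Suc.IH) (metis frechet_derivative_cong_open[OF assms(1)] Suc.prems)
  moreover have "(\<forall>x\<in>S. F differentiable (at x)) \<longleftrightarrow> (\<forall>x\<in>S. G differentiable (at x))"
    by (intro ball_cong refl differentiable_cong_open[OF assms(1)]) (auto simp: Suc.prems)
  ultimately show ?case by simp
qed

lemma frechet_derivative_bounded_linear:
  assumes "bounded_linear L" "F differentiable (at x)"
  shows "frechet_derivative (\<lambda>y. L (F y)) (at x) v = L (frechet_derivative F (at x) v)"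
proof -
  have "((\<lambda>y. L (F y)) has_derivative (\<lambda>v. L (frechet_derivative F (at x) v))) (at x)"
    using assms by (auto intro: bounded_linear.has_derivative[OF assms(1)] simp flip: frechet_derivative_works)
  then show ?thesis by (simp flip: frechet_derivative_at)
qed

lemma differentiable_bounded_linear:
  assumes "bounded_linear L" "F differentiable (at x)"
  shows "(\<lambda>y. L (F y)) differentiable (at x)"
proof -
  obtain D where "(F has_derivative D) (at x)"
    using assms(2) by (auto simp: differentiable_def)
  then have "((\<lambda>y. L (F y)) has_derivative (\<lambda>v. L (D v))) (at x)"
    by (rule bounded_linear.has_derivative[OF assms(1)])
  then show ?thesis
    by (rule differentiableI)
qed

lemma C_k_on_bounded_linear:
  assumes "open S" "bounded_linear L" "C_k_on k F S"
  shows "C_k_on k (\<lambda>x. L (F x)) S"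
  using assms(3)
proof (induction k arbitrary: F)
  case 0
  then show ?case using assms(2) by (simp add: bounded_linear.continuous_on)
next
  case (Suc k)
  have "C_k_on k (\<lambda>x. L (frechet_derivative F (at x) v)) S" for v
    using Suc by simp
  then have "C_k_on k (\<lambda>x. frechet_derivative (\<lambda>y. L (F y)) (at x) v) S" for v
    using Suc.prems
    by (subst C_k_on_cong[OF assms(1) frechet_derivative_bounded_linear[OF assms(2)]]) auto
  then show ?case
    using Suc.prems differentiable_bounded_linear[OF assms(2)] by auto
qed

lemma C_k_on_add:
  assumes "open S" "C_k_on k F S" "C_k_on k G S"
  shows "C_k_on k (\<lambda>x. F x + G x) S"
  using assms(2,3)
proof (induction k arbitrary: F G)
  case 0
  then show ?case by (simp add: continuous_on_add)
next
  case (Suc k)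
  have "frechet_derivative (\<lambda>y. F y + G y) (at x) v = frechet_derivative F (at x) v + frechet_derivative G (at x) v"
    if "x \<in> S" for x v
  proof -
    have "((\<lambda>y. F y + G y) has_derivative (\<lambda>v. frechet_derivative F (at x) v + frechet_derivative G (at x) v)) (at x)"
      using Suc.prems that by (intro has_derivative_add) (auto simp flip: frechet_derivative_works)
    then show ?thesis by (simp flip: frechet_derivative_at)
  qed
  then have "C_k_on k (\<lambda>x. frechet_derivative (\<lambda>y. F y + G y) (at x) v) S" for v
    using Suc by (subst C_k_on_cong[OF assms(1)]) auto
  then show ?case
    using Suc.prems by (auto intro: differentiable_add)
qed

lemma smooth_on_bounded_linear:
  "open S \<Longrightarrow> bounded_linear L \<Longrightarrow> smooth_on F S \<Longrightarrow> smooth_on (\<lambda>x. L (F x)) S"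
  by (simp add: smooth_on_def C_k_on_bounded_linear)

lemma smooth_on_add:
  "open S \<Longrightarrow> smooth_on F S \<Longrightarrow> smooth_on G S \<Longrightarrow> smooth_on (\<lambda>x. F x + G x) S"
  by (simp add: smooth_on_def C_k_on_add)

lemma smooth_on_imp_differentiable: "smooth_on F S \<Longrightarrow> x \<in> S \<Longrightarrow> F differentiable (at x)"
  unfolding smooth_on_def by (metis C_k_on.simps(2))

lemma smooth_on_imp_continuous_on: "smooth_on F S \<Longrightarrow> continuous_on S F"
  unfolding smooth_on_def by (metis C_k_on.simps(1))

lemma smooth_on_frechet_derivative: "smooth_on F S \<Longrightarrow> smooth_on (\<lambda>x. frechet_derivative F (at x) v) S"
  unfolding smooth_on_def by (metis C_k_on.simps(2))

section \<open>Symmetry of second derivatives\<close>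

lemma has_real_derivative_along_line:
  fixes h :: "'a::real_normed_vector \<Rightarrow> real"
  assumes "h differentiable (at (a + \<tau> *\<^sub>R v))"
  shows "((\<lambda>\<tau>. h (a + \<tau> *\<^sub>R v)) has_real_derivative frechet_derivative h (at (a + \<tau> *\<^sub>R v)) v) (at \<tau>)"
proof -
  let ?D = "frechet_derivative h (at (a + \<tau> *\<^sub>R v))"
  have D: "(h has_derivative ?D) (at (a + \<tau> *\<^sub>R v))"
    using assms by (simp flip: frechet_derivative_works)
  have "((\<lambda>\<tau>. a + \<tau> *\<^sub>R v) has_derivative (\<lambda>\<sigma>. \<sigma> *\<^sub>R v)) (at \<tau>)"
    by (auto intro!: derivative_eq_intros)
  then have "((\<lambda>\<tau>. h (a + \<tau> *\<^sub>R v)) has_derivative (\<lambda>\<sigma>. ?D (\<sigma> *\<^sub>R v))) (at \<tau>)"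
    using D by (rule has_derivative_compose)
  moreover have "?D (\<sigma> *\<^sub>R v) = ?D v * \<sigma>" for \<sigma>
    using linear_cmul[OF has_derivative_linear[OF D]] by simp
  ultimately show ?thesis
    by (simp add: has_field_derivative_def mult_commute_abs)
qed

text \<open>The alternating sum over the corners of a parallelogram is an increment in direction
  \<open>v\<close> of an increment in direction \<open>w\<close>; the mean value theorem is applied
  once in each direction. The sum itself is symmetric in \<open>v\<close> and \<open>w\<close>,
  which is what the symmetry of the second derivatives exploits.\<close>

lemma second_difference_mvt:
  fixes h :: "'a::real_normed_vector \<Rightarrow> real"
  assumes ball: "ball z d \<subseteq> S" and t: "0 < t" "t * (norm v + norm w) < d"
    and h: "\<And>x. x \<in> S \<Longrightarrow> h differentiable (at x)"
    and h': "\<And>x. x \<in> S \<Longrightarrow> (\<lambda>y. frechet_derivative h (at y) v) differentiable (at x)"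
  shows "\<exists>p\<in>ball z d. h (z + t *\<^sub>R v + t *\<^sub>R w) - h (z + t *\<^sub>R v) - h (z + t *\<^sub>R w) + h z
    = t\<^sup>2 * frechet_derivative (\<lambda>y. frechet_derivative h (at y) v) (at p) w"
proof -
  define D where "D x = frechet_derivative h (at x) v" for x
  have inb: "z + \<xi> *\<^sub>R v + \<eta> *\<^sub>R w \<in> ball z d" if "0 \<le> \<xi>" "\<xi> \<le> t" "0 \<le> \<eta>" "\<eta> \<le> t" for \<xi> \<eta>
  proof -
    have "norm (\<xi> *\<^sub>R v + \<eta> *\<^sub>R w) \<le> \<xi> * norm v + \<eta> * norm w"
      using that norm_triangle_ineq[of "\<xi> *\<^sub>R v" "\<eta> *\<^sub>R w"] by simp
    also have "\<dots> \<le> t * norm v + t * norm w"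
      using that by (intro add_mono mult_right_mono) auto
    also have "\<dots> < d"
      using t by (simp add: distrib_left)
    also have "norm (\<xi> *\<^sub>R v + \<eta> *\<^sub>R w) = dist (z + (\<xi> *\<^sub>R v + \<eta> *\<^sub>R w)) z"
      by (simp add: dist_norm)
    finally show ?thesis
      by (simp add: dist_commute add.assoc)
  qed
  have "\<exists>\<xi>>0. \<xi> < t \<and> (h (z + t *\<^sub>R w + t *\<^sub>R v) - h (z + t *\<^sub>R v)) - (h (z + t *\<^sub>R w + 0 *\<^sub>R v) - h (z + 0 *\<^sub>R v))
      = (t - 0) * (D (z + t *\<^sub>R w + \<xi> *\<^sub>R v) - D (z + \<xi> *\<^sub>R v))"
  proof (rule MVT2[OF t(1)])
    fix \<xi> assume "0 \<le> \<xi>" "\<xi> \<le> t"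
    then have "z + t *\<^sub>R w + \<xi> *\<^sub>R v \<in> S" "z + \<xi> *\<^sub>R v \<in> S"
      using inb[of \<xi> t] inb[of \<xi> 0] ball t by (auto simp: add_ac)
    then show "((\<lambda>\<xi>. h (z + t *\<^sub>R w + \<xi> *\<^sub>R v) - h (z + \<xi> *\<^sub>R v)) has_real_derivative
        D (z + t *\<^sub>R w + \<xi> *\<^sub>R v) - D (z + \<xi> *\<^sub>R v)) (at \<xi>)"
      unfolding D_def by (intro DERIV_diff has_real_derivative_along_line h)
  qed
  then obtain \<xi> where \<xi>: "0 < \<xi>" "\<xi> < t"
    and 1: "h (z + t *\<^sub>R v + t *\<^sub>R w) - h (z + t *\<^sub>R v) - h (z + t *\<^sub>R w) + h z
      = t * (D (z + \<xi> *\<^sub>R v + t *\<^sub>R w) - D (z + \<xi> *\<^sub>R v))"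
    by (auto simp: algebra_simps)
  have "\<exists>\<eta>>0. \<eta> < t \<and> D (z + \<xi> *\<^sub>R v + t *\<^sub>R w) - D (z + \<xi> *\<^sub>R v + 0 *\<^sub>R w)
      = (t - 0) * frechet_derivative D (at (z + \<xi> *\<^sub>R v + \<eta> *\<^sub>R w)) w"
  proof (rule MVT2[OF t(1)])
    fix \<eta> assume "0 \<le> \<eta>" "\<eta> \<le> t"
    then have "z + \<xi> *\<^sub>R v + \<eta> *\<^sub>R w \<in> S"
      using \<xi> by (intro subsetD[OF ball] inb) simp_all
    then show "((\<lambda>\<eta>. D (z + \<xi> *\<^sub>R v + \<eta> *\<^sub>R w)) has_real_derivative
        frechet_derivative D (at (z + \<xi> *\<^sub>R v + \<eta> *\<^sub>R w)) w) (at \<eta>)"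
      unfolding D_def by (intro has_real_derivative_along_line h')
  qed
  then obtain \<eta> where \<eta>: "0 < \<eta>" "\<eta> < t"
    and 2: "D (z + \<xi> *\<^sub>R v + t *\<^sub>R w) - D (z + \<xi> *\<^sub>R v) = t * frechet_derivative D (at (z + \<xi> *\<^sub>R v + \<eta> *\<^sub>R w)) w"
    by (auto simp only: scaleR_zero_left add_0_right diff_0_right)
  show ?thesis
    using inb[of \<xi> \<eta>] \<xi> \<eta> 1 2 by (intro bexI[of _ "z + \<xi> *\<^sub>R v + \<eta> *\<^sub>R w"]) (simp_all add: power2_eq_square D_def[abs_def])
qed

text \<open>The same second difference is evaluated in both orders, so the two mixed derivatives
  agree at two possibly different points near \<open>z\<close>; continuity carries this over to
  \<open>z\<close>.\<close>

lemma second_derivative_symmetric_real: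
  fixes h :: "'a::real_normed_vector \<Rightarrow> real"
  assumes S: "open S" "z \<in> S" and h: "smooth_on h S"
  shows "frechet_derivative (\<lambda>y. frechet_derivative h (at y) v) (at z) w
    = frechet_derivative (\<lambda>y. frechet_derivative h (at y) w) (at z) v"
proof -
  define H where "H v w x = frechet_derivative (\<lambda>y. frechet_derivative h (at y) v) (at x) w" for v w x
  have diff: "(\<lambda>y. frechet_derivative h (at y) v) differentiable (at x)" if "x \<in> S" for x v
    using h that by (intro smooth_on_imp_differentiable smooth_on_frechet_derivative)
  have "continuous_on S (H v w)" for v w
    unfolding H_def by (intro smooth_on_imp_continuous_on smooth_on_frechet_derivative h)
  then have lim: "(H v w \<longlongrightarrow> H v w z) (at z)" for v w
    using S by (simp add: continuous_on_eq_continuous_at isCont_def)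
  have "dist (H v w z) (H w v z) \<le> e" if "e > 0" for e
  proof -
    have "eventually (\<lambda>x. x \<in> S \<and> dist (H v w x) (H v w z) < e / 2 \<and> dist (H w v x) (H w v z) < e / 2) (nhds z)"
      using S tendstoD[OF lim[of v w], of "e / 2"] tendstoD[OF lim[of w v], of "e / 2"] \<open>e > 0\<close>
      by (intro eventually_conj eventually_nhds_in_open) (simp_all add: eventually_nhds_conv_at)
    then obtain d where d: "d > 0" "\<And>x. dist x z < d \<Longrightarrow> x \<in> S \<and> dist (H v w x) (H v w z) < e / 2 \<and> dist (H w v x) (H w v z) < e / 2"
      by (auto simp: eventually_nhds_metric)
    then have ball: "ball z d \<subseteq> S" by (auto simp: dist_commute)
    \<comment> \<open>The summand 1 keeps \<open>N\<close> positive when both directions vanish; the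
      half in \<open>t\<close> gives room for the strict inequality.\<close>
    define N where "N = norm v + norm w + 1"
    define t where "t = d / 2 / N"
    have N: "N > 0" by (simp add: N_def add_nonneg_pos)
    then have t: "t > 0" using d(1) by (simp add: t_def)
    have "t * (norm v + norm w) \<le> t * N" using t by (simp add: N_def)
    also have "t * N = d / 2" using N by (simp add: t_def)
    also have "d / 2 < d" using d(1) by simp
    finally have td: "t * (norm v + norm w) < d" .
    have "\<exists>p\<in>ball z d. h (z + t *\<^sub>R v + t *\<^sub>R w) - h (z + t *\<^sub>R v) - h (z + t *\<^sub>R w) + h z = t\<^sup>2 * H v w p"
      unfolding H_def by (rule second_difference_mvt[OF ball t td smooth_on_imp_differentiable[OF h] diff])
    then obtain p where p: "p \<in> ball z d"
      "h (z + t *\<^sub>R v + t *\<^sub>R w) - h (z + t *\<^sub>R v) - h (z + t *\<^sub>R w) + h z = t\<^sup>2 * H v w p" ..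
    have td': "t * (norm w + norm v) < d"
      using td by (simp add: add.commute)
    have "\<exists>q\<in>ball z d. h (z + t *\<^sub>R w + t *\<^sub>R v) - h (z + t *\<^sub>R w) - h (z + t *\<^sub>R v) + h z = t\<^sup>2 * H w v q"
      unfolding H_def by (rule second_difference_mvt[OF ball t td' smooth_on_imp_differentiable[OF h] diff])
    then obtain q where q: "q \<in> ball z d"
      "h (z + t *\<^sub>R w + t *\<^sub>R v) - h (z + t *\<^sub>R w) - h (z + t *\<^sub>R v) + h z = t\<^sup>2 * H w v q" ..
    have "z + t *\<^sub>R w + t *\<^sub>R v = z + t *\<^sub>R v + t *\<^sub>R w"
      by (simp add: add_ac)
    then have "t\<^sup>2 * H v w p = t\<^sup>2 * H w v q"
      using p(2) q(2) by (simp only:)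
    then have eq: "H v w p = H w v q"
      using t by simp
    have "dist (H v w p) (H v w z) < e / 2" "dist (H w v q) (H w v z) < e / 2"
      using d(2)[of p] d(2)[of q] p(1) q(1) by (auto simp: dist_commute)
    then show ?thesis
      unfolding eq dist_real_def by linarith
  qed
  then have "dist (H v w z) (H w v z) \<le> 0"
    by (rule field_le_epsilon) auto
  then show ?thesis by (simp add: H_def)
qed

text \<open>The mean value argument concerns real values, so it is applied to the real and imaginary
  parts separately.\<close>

lemma second_derivative_symmetric:
  fixes F :: "'a::real_normed_vector \<Rightarrow> complex"
  assumes S: "open S" "z \<in> S" and F: "smooth_on F S"
  shows "frechet_derivative (\<lambda>y. frechet_derivative F (at y) v) (at z) w
    = frechet_derivative (\<lambda>y. frechet_derivative F (at y) w) (at z) v"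
proof -
  have *: "L (frechet_derivative (\<lambda>y. frechet_derivative F (at y) v) (at z) w)
      = frechet_derivative (\<lambda>y. frechet_derivative (\<lambda>x. L (F x)) (at y) v) (at z) w"
    if L: "bounded_linear L" for L :: "complex \<Rightarrow> real" and v w
  proof -
    have "L (frechet_derivative (\<lambda>y. frechet_derivative F (at y) v) (at z) w)
      = frechet_derivative (\<lambda>y. L (frechet_derivative F (at y) v)) (at z) w"
      using S F L by (intro frechet_derivative_bounded_linear[symmetric] smooth_on_imp_differentiable
          smooth_on_frechet_derivative)
    also have "frechet_derivative (\<lambda>y. L (frechet_derivative F (at y) v)) (at z)
       = frechet_derivative (\<lambda>y. frechet_derivative (\<lambda>x. L (F x)) (at y) v) (at z)"
      using S F L by (intro frechet_derivative_cong_open[OF S] frechet_derivative_bounded_linear[symmetric]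
          smooth_on_imp_differentiable)
    finally show ?thesis .
  qed
  show ?thesis
    using *[OF bounded_linear_Re] *[OF bounded_linear_Im]
      second_derivative_symmetric_real[OF S smooth_on_bounded_linear[OF S(1) bounded_linear_Re F]]
      second_derivative_symmetric_real[OF S smooth_on_bounded_linear[OF S(1) bounded_linear_Im F]]
    by (intro complex_eqI) metis+
qed

text \<open>The cases \<open>s = - \<i>\<close> and \<open>s = \<i>\<close> are the two Wirtinger derivatives.\<close>

definition wd :: "complex \<Rightarrow> 'n::finite \<Rightarrow> (complex^'n \<Rightarrow> complex) \<Rightarrow> complex^'n \<Rightarrow> complex" where
  "wd s i F z = (frechet_derivative F (at z) (axis i 1) + s * frechet_derivative F (at z) (axis i \<i>)) / 2"

lemma d_z_eq_wd: "d_z = wd (- \<i>)"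
  by (simp add: fun_eq_iff d_z_def wd_def)

lemma d_zbar_eq_wd: "d_zbar = wd \<i>"
  by (simp add: fun_eq_iff d_zbar_def wd_def)

section \<open>Rules of calculus for Wirtinger derivatives\<close>

lemma wd_eq:
  assumes "(F has_derivative D) (at z)"
  shows "wd s i F z = (D (axis i 1) + s * D (axis i \<i>)) / 2"
  using frechet_derivative_at[OF assms] by (simp add: wd_def)

lemma wd_cong_open:
  assumes "open S" "z \<in> S" "\<And>y. y \<in> S \<Longrightarrow> F y = G y"
  shows "wd s i F z = wd s i G z"
  using frechet_derivative_cong_open[OF assms] by (simp add: wd_def)

lemma wd_const [simp]: "wd s i (\<lambda>w. c) z = 0"
  by (simp add: wd_def)

lemma wd_diff:
  assumes "F differentiable (at z)" "G differentiable (at z)"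
  shows "wd s i (\<lambda>w. F w - G w) z = wd s i F z - wd s i G z"
proof -
  obtain F' G' where D: "(F has_derivative F') (at z)" "(G has_derivative G') (at z)"
    using assms by (auto simp: differentiable_def)
  show ?thesis
    by (simp add: wd_eq[OF has_derivative_diff[OF D]] wd_eq[OF D(1)] wd_eq[OF D(2)] field_simps)
qed

lemma wd_sum:
  assumes "\<And>a. a \<in> I \<Longrightarrow> F a differentiable (at z)"
  shows "wd s i (\<lambda>w. \<Sum>a\<in>I. F a w) z = (\<Sum>a\<in>I. wd s i (F a) z)"
proof -
  have D: "(F a has_derivative frechet_derivative (F a) (at z)) (at z)" if "a \<in> I" for a
    using assms that by (simp flip: frechet_derivative_works)
  show ?thesis
    by (subst wd_eq[OF has_derivative_sum[OF D]])
      (simp_all add: wd_def sum.distrib sum_distrib_left flip: sum_divide_distrib)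
qed

lemma wd_mult:
  assumes "F differentiable (at z)" "G differentiable (at z)"
  shows "wd s i (\<lambda>w. F w * G w) z = wd s i F z * G z + F z * wd s i G z"
proof -
  obtain F' G' where D: "(F has_derivative F') (at z)" "(G has_derivative G') (at z)"
    using assms by (auto simp: differentiable_def)
  show ?thesis
    by (simp add: wd_eq[OF has_derivative_mult[OF D]] wd_eq[OF D(1)] wd_eq[OF D(2)] field_simps)
qed

lemma wd_divide:
  assumes "F differentiable (at z)" "G differentiable (at z)" "G z \<noteq> 0"
  shows "wd s i (\<lambda>w. F w / G w) z = wd s i F z / G z - F z * wd s i G z / (G z)\<^sup>2"
proof -
  obtain F' G' where D: "(F has_derivative F') (at z)" "(G has_derivative G') (at z)"
    using assms by (auto simp: differentiable_def)
  show ?thesis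
    using assms(3)
    by (simp add: wd_eq[OF has_derivative_divide'[OF D assms(3)]] wd_eq[OF D(1)] wd_eq[OF D(2)] field_simps
        power2_eq_square)
qed

lemma wd_prod:
  assumes "\<And>a. a \<in> I \<Longrightarrow> F a differentiable (at z)"
  shows "wd s i (\<lambda>w. \<Prod>a\<in>I. F a w) z = (\<Sum>a\<in>I. wd s i (F a) z * (\<Prod>b\<in>I - {a}. F b z))"
proof -
  have D: "(F a has_derivative frechet_derivative (F a) (at z)) (at z)" if "a \<in> I" for a
    using assms that by (simp flip: frechet_derivative_works)
  show ?thesis
    by (subst wd_eq[OF has_derivative_prod[OF D]])
      (simp_all add: wd_def sum.distrib sum_distrib_left field_simps flip: sum_divide_distrib)
qed

text \<open>Directional derivatives commute with conjugation, so only the coefficient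
  \<open>s\<close> is conjugated: the two Wirtinger derivatives trade places.\<close>

lemma wd_cnj:
  assumes "F differentiable (at z)"
  shows "wd s i (\<lambda>w. cnj (F w)) z = cnj (wd (cnj s) i F z)"
  using assms by (simp add: wd_def frechet_derivative_bounded_linear[OF bounded_linear_cnj])

lemma wd_ln:
  assumes "h differentiable (at z)" "h z > 0"
  shows "wd s i (\<lambda>w. of_real (ln (h w))) z = wd s i (\<lambda>w. of_real (h w)) z / of_real (h z)"
proof -
  obtain h' where D: "(h has_derivative h') (at z)"
    using assms by (auto simp: differentiable_def)
  have "((\<lambda>w. ln (h w)) has_derivative (\<lambda>v. h' v / h z)) (at z)"
    using D assms(2) by (auto intro!: derivative_eq_intros simp: field_simps)
  from has_derivative_of_real[OF this] have
    "((\<lambda>w. complex_of_real (ln (h w))) has_derivative (\<lambda>v. of_real (h' v / h z))) (at z)" .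
  from wd_eq[OF this, of s i] wd_eq[OF has_derivative_of_real[OF D], of s i] show ?thesis
    by (simp add: add_divide_distrib mult.commute)
qed

lemma smooth_on_wd:
  assumes "open S" "smooth_on F S"
  shows "smooth_on (wd s i F) S"
proof -
  have "smooth_on (\<lambda>z. frechet_derivative F (at z) (axis i 1) / 2 + s / 2 * frechet_derivative F (at z) (axis i \<i>)) S"
    by (intro smooth_on_add smooth_on_bounded_linear[OF assms(1) bounded_linear_divide]
        smooth_on_bounded_linear[OF assms(1) bounded_linear_mult_right] smooth_on_frechet_derivative assms)
  then show ?thesis
    by (simp add: wd_def[abs_def] add_divide_distrib)
qed

lemma wd_commute:
  assumes "open S" "z \<in> S" "smooth_on F S"
  shows "wd s i (wd t j F) z = wd t j (wd s i F) z"
proof -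
  let ?D = "\<lambda>v w. frechet_derivative (\<lambda>y. frechet_derivative F (at y) v) (at z) w"
  have *: "wd s i (wd t j F) z = (?D (axis j 1) (axis i 1) + t * ?D (axis j \<i>) (axis i 1)
      + s * (?D (axis j 1) (axis i \<i>) + t * ?D (axis j \<i>) (axis i \<i>))) / 4" for s t i j
  proof -
    have D: "((\<lambda>y. frechet_derivative F (at y) v) has_derivative ?D v) (at z)" for v
      using smooth_on_imp_differentiable[OF smooth_on_frechet_derivative[OF assms(3)] assms(2)]
      by (simp flip: frechet_derivative_works)
    have "(wd t j F has_derivative (\<lambda>w. (?D (axis j 1) w + t * ?D (axis j \<i>) w) / 2)) (at z)"
      unfolding wd_def[abs_def] by (auto intro!: derivative_eq_intros D)
    from wd_eq[OF this, of s i] show ?thesis by (simp add: algebra_simps add_divide_distrib)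
  qed
  show ?thesis
    unfolding * by (simp add: second_derivative_symmetric[OF assms] algebra_simps)
qed

section \<open>Derivatives of matrix-valued functions\<close>

definition matrix_differentiable :: "(complex^'n::finite \<Rightarrow> complex^'q^'p) \<Rightarrow> complex^'n \<Rightarrow> bool" where
  "matrix_differentiable A z \<longleftrightarrow> (\<forall>i j. (\<lambda>w. A w $ i $ j) differentiable (at z))"

definition matrix_wd :: "complex \<Rightarrow> 'n::finite \<Rightarrow> (complex^'n \<Rightarrow> complex^'q^'p) \<Rightarrow> complex^'n \<Rightarrow> complex^'q^'p" where
  "matrix_wd s k A z = (\<chi> i j. wd s k (\<lambda>w. A w $ i $ j) z)"

lemma matrix_wd_nth [simp]: "matrix_wd s k A z $ i $ j = wd s k (\<lambda>w. A w $ i $ j) z"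
  by (simp add: matrix_wd_def)

lemma matrix_differentiable_mult:
  assumes "matrix_differentiable A z" "matrix_differentiable B z"
  shows "matrix_differentiable (\<lambda>w. A w ** B w) z"
  using assms unfolding matrix_differentiable_def matrix_matrix_mult_def
  by (auto intro!: differentiable_sum differentiable_mult)

lemma matrix_wd_mult:
  assumes "matrix_differentiable A z" "matrix_differentiable B z"
  shows "matrix_wd s k (\<lambda>w. A w ** B w) z = matrix_wd s k A z ** B z + A z ** matrix_wd s k B z"
  using assms unfolding matrix_differentiable_def matrix_matrix_mult_def
  by (simp add: vec_eq_iff wd_sum wd_mult sum.distrib)

lemma matrix_wd_cong_open:
  assumes "open S" "z \<in> S" "\<And>y. y \<in> S \<Longrightarrow> A y = B y"
  shows "matrix_wd s k A z = matrix_wd s k B z"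
  using assms by (auto simp: vec_eq_iff intro!: wd_cong_open)

lemma matrix_differentiable_const [simp]: "matrix_differentiable (\<lambda>w. C) z"
  by (simp add: matrix_differentiable_def)

lemma matrix_wd_const [simp]: "matrix_wd s k (\<lambda>w. C) z = 0"
  by (simp add: vec_eq_iff)

lemma differentiable_trace:
  "matrix_differentiable A z \<Longrightarrow> (\<lambda>w. trace (A w)) differentiable (at z)"
  by (simp add: matrix_differentiable_def trace_def)

lemma wd_trace:
  "matrix_differentiable A z \<Longrightarrow> wd s k (\<lambda>w. trace (A w)) z = trace (matrix_wd s k A z)"
  by (simp add: matrix_differentiable_def trace_def wd_sum)

section \<open>Inverses and determinants\<close>

lemma differentiable_prod:
  fixes F :: "'a \<Rightarrow> 'b::real_normed_vector \<Rightarrow> complex"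
  assumes "\<And>a. a \<in> I \<Longrightarrow> F a differentiable (at z)"
  shows "(\<lambda>w. \<Prod>a\<in>I. F a w) differentiable (at z)"
proof -
  have "(F a has_derivative frechet_derivative (F a) (at z)) (at z)" if "a \<in> I" for a
    using assms that by (simp flip: frechet_derivative_works)
  from has_derivative_prod[OF this] show ?thesis
    by (rule differentiableI)
qed

lemma differentiable_det:
  fixes A :: "complex^'n::finite \<Rightarrow> complex^'m::finite^'m"
  assumes "matrix_differentiable A z"
  shows "(\<lambda>w. det (A w)) differentiable (at z)"
proof -
  have "(\<lambda>w. \<Prod>i\<in>UNIV. A w $ i $ p i) differentiable (at z)" for p
    using assms by (intro differentiable_prod) (simp add: matrix_differentiable_def)
  then show ?thesis
    unfolding det_def by (intro differentiable_sum differentiable_mult differentiable_const) auto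
qed

text \<open>As quotients of determinants, the entries of the inverse inherit differentiability from
  the polynomial \<open>det\<close>.\<close>

lemma matrix_inv_nth_cramer:
  fixes A :: "complex^'n::finite^'n"
  assumes "invertible A"
  shows "matrix_inv A $ i $ j = det (\<chi> p q. if q = i then axis j 1 $ p else A $ p $ q) / det A"
proof -
  have "A *v column j (matrix_inv A) = axis j 1"
    using matrix_inv_inverse(1)[OF assms]
    by (simp add: vec_eq_iff matrix_vector_mult_def matrix_matrix_mult_def column_def axis_def mat_def)
  then have "column j (matrix_inv A) = (\<chi> k. det (\<chi> p q. if q = k then axis j 1 $ p else A $ p $ q) / det A)"
    using assms by (subst (asm) cramer) (auto simp: invertible_det_nz)
  then show ?thesis
    by (simp add: vec_eq_iff column_def)
qed

lemma matrix_differentiable_inverse: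
  fixes A :: "complex^'n::finite \<Rightarrow> complex^'m::finite^'m"
  assumes "open S" "z \<in> S" "\<And>w. w \<in> S \<Longrightarrow> invertible (A w)" "matrix_differentiable A z"
  shows "matrix_differentiable (\<lambda>w. matrix_inv (A w)) z"
proof -
  have "(\<lambda>w. det (\<chi> p q. if q = i then axis j 1 $ p else A w $ p $ q) / det (A w)) differentiable (at z)" for i j
  proof (intro differentiable_divide differentiable_det assms(4))
    have "(\<lambda>w. if q = i then axis j 1 $ p else A w $ p $ q) differentiable (at z)" for p q
      using assms(4) by (cases "q = i") (simp_all add: matrix_differentiable_def)
    then show "matrix_differentiable (\<lambda>w. \<chi> p q. if q = i then axis j 1 $ p else A w $ p $ q) z"
      by (simp add: matrix_differentiable_def)
    show "det (A z) \<noteq> 0"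
      using assms(2,3) by (simp add: invertible_det_nz)
  qed
  moreover have "(\<lambda>w. matrix_inv (A w) $ i $ j) differentiable (at z) \<longleftrightarrow>
    (\<lambda>w. det (\<chi> p q. if q = i then axis j 1 $ p else A w $ p $ q) / det (A w)) differentiable (at z)" for i j
    by (rule differentiable_cong_open[OF assms(1,2)]) (simp add: matrix_inv_nth_cramer assms(3))
  ultimately show ?thesis
    by (simp add: matrix_differentiable_def)
qed

lemma matrix_wd_inverse:
  fixes A :: "complex^'n::finite \<Rightarrow> complex^'m::finite^'m"
  assumes "open S" "z \<in> S" "\<And>w. w \<in> S \<Longrightarrow> invertible (A w)" "matrix_differentiable A z"
  shows "matrix_wd s k (\<lambda>w. matrix_inv (A w)) z = - (matrix_inv (A z) ** matrix_wd s k A z ** matrix_inv (A z))"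
proof -
  note inv = matrix_inv_inverse[OF assms(3)[OF assms(2)]]
  have "matrix_wd s k (\<lambda>w. matrix_inv (A w) ** A w) z = matrix_wd s k (\<lambda>w. mat 1) z"
    by (rule matrix_wd_cong_open[OF assms(1,2)]) (simp add: matrix_inv_inverse assms(3))
  then have "matrix_wd s k (\<lambda>w. matrix_inv (A w)) z ** A z + matrix_inv (A z) ** matrix_wd s k A z = 0"
    by (simp add: matrix_wd_mult[OF matrix_differentiable_inverse[OF assms] assms(4)])
  then have "(matrix_wd s k (\<lambda>w. matrix_inv (A w)) z ** A z + matrix_inv (A z) ** matrix_wd s k A z) ** matrix_inv (A z) = 0"
    by simp
  then have "matrix_wd s k (\<lambda>w. matrix_inv (A w)) z + matrix_inv (A z) ** matrix_wd s k A z ** matrix_inv (A z) = 0"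
    by (simp add: matrix_add_rdistrib inv flip: matrix_mul_assoc)
  then show ?thesis
    by (simp add: eq_neg_iff_add_eq_0)
qed

text \<open>The identity permutation is the only one that moves at most one point.\<close>

lemma wd_det_at_mat_1:
  fixes B :: "complex^'n::finite \<Rightarrow> complex^'m::finite^'m"
  assumes "matrix_differentiable B z" "B z = mat 1"
  shows "wd s k (\<lambda>w. det (B w)) z = trace (matrix_wd s k B z)"
proof -
  have d: "(\<lambda>w. B w $ i $ j) differentiable (at z)" for i j
    using assms(1) by (simp add: matrix_differentiable_def)
  let ?P = "{p. p permutes (UNIV :: 'm set)}"
  let ?t = "\<lambda>p. of_int (sign p) * (\<Sum>i\<in>UNIV. wd s k (\<lambda>w. B w $ i $ p i) z * (\<Prod>j\<in>UNIV - {i}. B z $ j $ p j))"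
  have "wd s k (\<lambda>w. det (B w)) z = (\<Sum>p\<in>?P. ?t p)"
    unfolding det_def
    by (subst wd_sum wd_mult wd_prod; (simp add: d differentiable_prod)?)+
  also have "\<dots> = (\<Sum>p\<in>{id}. ?t p)"
  proof (rule sum.mono_neutral_right)
    show "\<forall>p\<in>?P - {id}. ?t p = 0"
    proof
      fix p assume p: "p \<in> ?P - {id}"
      have off_diagonal: "B z $ j $ p j = 0" if "p j \<noteq> j" for j
        using that by (simp add: assms(2) mat_def)
      have "\<exists>j\<in>UNIV - {i}. p j \<noteq> j" for i
      proof (rule ccontr)
        assume "\<not> ?thesis"
        then have fix_p: "p j = j" if "j \<noteq> i" for j using that by auto
        \<comment> \<open>Otherwise \<open>p i\<close> is a fixed point other than \<open>i\<close>,
          and \<open>i\<close> and \<open>p i\<close> have the same image.\<close>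
        have "p i = i"
          using p fix_p permutes_inj[of p UNIV] by (metis DiffD1 injD mem_Collect_eq)
        with fix_p have "p = id" by (metis eq_id_iff)
        with p show False by simp
      qed
      then have "\<exists>j\<in>UNIV - {i}. B z $ j $ p j = 0" for i
        using off_diagonal by metis
      then have "(\<Prod>j\<in>UNIV - {i}. B z $ j $ p j) = 0" for i
        by (intro prod_zero) simp_all
      then show "?t p = 0" by (simp only: mult_zero_right sum.neutral_const)
    qed
  qed (auto simp: finite_permutations permutes_id)
  also have "\<dots> = trace (matrix_wd s k B z)"
    by (simp add: assms(2) mat_def trace_def sign_id)
  finally show ?thesis .
qed

text \<open>Jacobi's formula. Multiplying by the constant matrix \<open>matrix_inv (A z)\<close>
  reduces it to a function with value \<open>mat 1\<close> at \<open>z\<close>.\<close>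

lemma wd_det:
  fixes A :: "complex^'n::finite \<Rightarrow> complex^'m::finite^'m"
  assumes "matrix_differentiable A z" "invertible (A z)"
  shows "wd s k (\<lambda>w. det (A w)) z = det (A z) * trace (matrix_inv (A z) ** matrix_wd s k A z)"
proof -
  note inv = matrix_inv_inverse[OF assms(2)]
  let ?B = "\<lambda>w. matrix_inv (A z) ** A w"
  have B: "matrix_differentiable ?B z"
    by (intro matrix_differentiable_mult assms) simp
  have "det (A w) = det (A z) * det (?B w)" for w
    using arg_cong[OF inv(1), of det] by (simp add: det_mul)
  then have "wd s k (\<lambda>w. det (A w)) z = wd s k (\<lambda>w. det (A z) * det (?B w)) z"
    by (intro wd_cong_open[OF open_UNIV UNIV_I])
  also have "\<dots> = det (A z) * wd s k (\<lambda>w. det (?B w)) z"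
    by (simp add: wd_mult differentiable_det[OF B])
  also have "wd s k (\<lambda>w. det (?B w)) z = trace (matrix_inv (A z) ** matrix_wd s k A z)"
    by (simp add: wd_det_at_mat_1[OF B inv(2)] matrix_wd_mult assms)
  finally show ?thesis .
qed

text \<open>The Gram factorisation makes the determinant the squared modulus of
  \<open>det T\<close>.\<close>

lemma det_hermitian_pos_def:
  fixes A :: "complex^'n::finite^'n"
  assumes "hermitian_pos_def A"
  shows "Im (det A) = 0" "Re (det A) > 0"
proof -
  obtain T :: "complex^'n^'n" where T: "A = T ** ctrans T"
    using gram_decomposition[OF assms] by blast
  have "ctrans T = (\<chi> i j. cnj (transpose T $ i $ j))"
    by (simp add: vec_eq_iff transpose_def)
  moreover have "det (\<chi> i j. cnj (C $ i $ j)) = cnj (det C)" for C :: "complex^'n^'n"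
    by (simp add: det_def)
  ultimately have "det A = det T * cnj (det T)"
    by (simp add: T det_mul)
  then have *: "det A = of_real ((norm (det T))\<^sup>2)"
    by (simp only: complex_norm_square)
  have "det A \<noteq> 0"
    using hermitian_pos_def_imp_invertible[OF assms] by (simp add: invertible_det_nz)
  with * show "Im (det A) = 0" "Re (det A) > 0" by auto
qed

section \<open>Hessian, Ricci tensor and curvature\<close>

text \<open>The one differentiation rule behind all the tensors: \<open>u\<close>, both terms of its
  first derivatives, and the first derivatives of the log-determinant are traces of this
  shape.\<close>

lemma wd_trace_inverse_mult:
  fixes A B :: "complex^'n::finite \<Rightarrow> complex^'m::finite^'m"
  assumes "open S" "z \<in> S" "\<And>w. w \<in> S \<Longrightarrow> invertible (A w)"
    and "matrix_differentiable A z" "matrix_differentiable B z"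
  shows "wd s k (\<lambda>w. trace (matrix_inv (A w) ** B w)) z = trace (matrix_inv (A z) ** matrix_wd s k B z)
    - trace (matrix_inv (A z) ** matrix_wd s k A z ** matrix_inv (A z) ** B z)"
  using matrix_differentiable_inverse[OF assms(1-4)] assms(5)
  by (simp add: wd_trace matrix_differentiable_mult matrix_wd_mult matrix_wd_inverse[OF assms(1-4)]
      trace_add trace_sub trace_minus matrix_minus_mult)

lemma complex_hessian_nth:
  "complex_hessian h w $ i $ j = wd (- \<i>) i (wd \<i> j (\<lambda>w. complex_of_real (h w))) w"
  by (simp add: complex_hessian_def d_z_eq_wd d_zbar_eq_wd)

section \<open>The Hessian of a single potential, to be used for both \<open>f\<close> and
  \<open>g\<close>\<close>

context
  fixes \<Omega> :: "(complex^'n::finite) set" and h :: "complex^'n \<Rightarrow> real"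
  assumes open_dom: "open \<Omega>" and smooth: "smooth_on h \<Omega>"
    and pos_def: "\<forall>z\<in>\<Omega>. hermitian_pos_def (complex_hessian h z)"
begin

lemma smooth_complex: "smooth_on (\<lambda>w. complex_of_real (h w)) \<Omega>"
  by (rule smooth_on_bounded_linear[OF open_dom bounded_linear_of_real smooth])

lemma smooth_hessian: "smooth_on (\<lambda>w. complex_hessian h w $ i $ j) \<Omega>"
  unfolding complex_hessian_nth by (intro smooth_on_wd open_dom smooth_complex)

lemma matrix_differentiable_hessian: "z \<in> \<Omega> \<Longrightarrow> matrix_differentiable (complex_hessian h) z"
  unfolding matrix_differentiable_def using smooth_on_imp_differentiable[OF smooth_hessian] by blast

lemma matrix_differentiable_wd_hessian: "z \<in> \<Omega> \<Longrightarrow> matrix_differentiable (matrix_wd s l (complex_hessian h)) z"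
  unfolding matrix_differentiable_def matrix_wd_nth
  using smooth_on_imp_differentiable[OF smooth_on_wd[OF open_dom smooth_hessian]] by blast

lemma hessian_hermitian: "z \<in> \<Omega> \<Longrightarrow> cnj (complex_hessian h z $ j $ i) = complex_hessian h z $ i $ j"
  using pos_def unfolding hermitian_pos_def_def by metis

text \<open>Hermitian symmetry on an open set can be differentiated. Consequently the barred first
  derivatives are the adjoints of the unbarred ones, and \<open>F1\<close>, \<open>G1\<close> alone
  describe all first derivatives.\<close>

lemma matrix_wd_hessian_ctrans:
  assumes "z \<in> \<Omega>"
  shows "matrix_wd (cnj s) l (complex_hessian h) z = ctrans (matrix_wd s l (complex_hessian h) z)"
proof -
  have "wd (cnj s) l (\<lambda>w. complex_hessian h w $ i $ j) z = wd (cnj s) l (\<lambda>w. cnj (complex_hessian h w $ j $ i)) z" for i j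
    by (rule wd_cong_open[OF open_dom assms]) (simp add: hessian_hermitian)
  also have "\<dots> i j = cnj (wd s l (\<lambda>w. complex_hessian h w $ j $ i) z)" for i j
    using smooth_on_imp_differentiable[OF smooth_hessian assms] by (simp add: wd_cnj)
  finally show ?thesis
    by (simp add: vec_eq_iff)
qed

text \<open>Conjugation transposes the entry and exchanges the types of the two derivatives;
  commuting them restores the original order of types with \<open>k\<close> and \<open>l\<close>
  swapped.\<close>

lemma matrix_wd2_hessian_ctrans:
  assumes "z \<in> \<Omega>"
  shows "ctrans (matrix_wd (- \<i>) k (matrix_wd \<i> l (complex_hessian h)) z) = matrix_wd (- \<i>) l (matrix_wd \<i> k (complex_hessian h)) z"
proof -
  have "cnj (wd (- \<i>) k (wd \<i> l (\<lambda>w. complex_hessian h w $ j $ i)) z) = wd (- \<i>) l (wd \<i> k (\<lambda>w. complex_hessian h w $ i $ j)) z" for i j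
  proof -
    have "cnj (wd (- \<i>) k (wd \<i> l (\<lambda>w. complex_hessian h w $ j $ i)) z) = wd \<i> k (\<lambda>w. cnj (wd \<i> l (\<lambda>w. complex_hessian h w $ j $ i) w)) z"
      using smooth_on_imp_differentiable[OF smooth_on_wd[OF open_dom smooth_hessian] assms] by (simp add: wd_cnj)
    also have "\<dots> = wd \<i> k (wd (- \<i>) l (\<lambda>w. complex_hessian h w $ i $ j)) z"
    proof (rule wd_cong_open[OF open_dom assms])
      fix y assume "y \<in> \<Omega>"
      from matrix_wd_hessian_ctrans[OF this, of \<i> l]
      show "cnj (wd \<i> l (\<lambda>w. complex_hessian h w $ j $ i) y) = wd (- \<i>) l (\<lambda>w. complex_hessian h w $ i $ j) y"
        by (simp add: vec_eq_iff)
    qed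
    also have "\<dots> = wd (- \<i>) l (wd \<i> k (\<lambda>w. complex_hessian h w $ i $ j)) z"
      by (rule wd_commute[OF open_dom assms smooth_hessian])
    finally show ?thesis .
  qed
  then show ?thesis
    by (simp add: vec_eq_iff matrix_wd_nth[abs_def])
qed

text \<open>The Kaehler condition, which holds because the metric comes from a potential whose
  derivatives commute.\<close>

lemma wd_hessian_symmetric:
  assumes "z \<in> \<Omega>"
  shows "matrix_wd (- \<i>) k (complex_hessian h) z $ i $ j = matrix_wd (- \<i>) i (complex_hessian h) z $ k $ j"
  unfolding matrix_wd_nth complex_hessian_nth
  by (rule wd_commute[OF open_dom assms smooth_on_wd[OF open_dom smooth_complex]])

lemma wd2_hessian_symmetric:
  assumes "z \<in> \<Omega>"
  shows "matrix_wd (- \<i>) k (matrix_wd \<i> l (complex_hessian h)) z $ i $ j = matrix_wd (- \<i>) i (matrix_wd \<i> j (complex_hessian h)) z $ k $ l"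
proof -
  define c where "c = (\<lambda>w. complex_of_real (h w))"
  have c: "smooth_on c \<Omega>" unfolding c_def by (rule smooth_complex)
  note [intro] = open_dom assms c smooth_on_wd
  \<comment> \<open>The exchange takes place beneath an outer derivative, so the inner equality is
    needed on the whole open set.\<close>
  have swap: "wd (- \<i>) k (wd \<i> l (wd (- \<i>) i (wd \<i> j c))) z = wd (- \<i>) k (wd (- \<i>) i (wd \<i> l (wd \<i> j c))) z" for k l i j
    by (rule wd_cong_open[OF open_dom assms], rule wd_commute) blast+
  have "wd (- \<i>) k (wd (- \<i>) i (wd \<i> l (wd \<i> j c))) z = wd (- \<i>) i (wd (- \<i>) k (wd \<i> l (wd \<i> j c))) z"
    by (rule wd_commute) blast+
  also have "\<dots> = wd (- \<i>) i (wd (- \<i>) k (wd \<i> j (wd \<i> l c))) z"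
    by (rule wd_cong_open[OF open_dom assms], rule wd_cong_open[OF open_dom], assumption, rule wd_commute) blast+
  finally show ?thesis
    by (simp add: complex_hessian_nth[abs_def] matrix_wd_nth[abs_def] swap flip: c_def)
qed

lemma inv_hessian: "z \<in> \<Omega> \<Longrightarrow> invertible (complex_hessian h z)"
  using pos_def by (blast intro: hermitian_pos_def_imp_invertible)

lemma matrix_differentiable_inv_hessian: "z \<in> \<Omega> \<Longrightarrow> matrix_differentiable (\<lambda>w. matrix_inv (complex_hessian h w)) z"
  by (rule matrix_differentiable_inverse[OF open_dom _ inv_hessian matrix_differentiable_hessian])

text \<open>The determinant is real and positive on the domain, so Jacobi's formula gives the barred
  derivative of its logarithm as a trace. This is derived on all of \<Omega> because it is
  differentiated once more.\<close>

lemma ricci_eq: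
  assumes z: "z \<in> \<Omega>"
  shows "ricci h z i j = ricci_matrix (matrix_inv (complex_hessian h z)) (\<lambda>k. matrix_wd (- \<i>) k (complex_hessian h) z)
    (\<lambda>k l. matrix_wd (- \<i>) k (matrix_wd \<i> l (complex_hessian h)) z) $ i $ j"
proof -
  let ?d = "\<lambda>w. Re (det (complex_hessian h w))"
  have "wd \<i> j (\<lambda>w. complex_of_real (ln (?d w))) w = trace (matrix_inv (complex_hessian h w) ** matrix_wd \<i> j (complex_hessian h) w)" if w: "w \<in> \<Omega>" for w
  proof -
    have real: "complex_of_real (?d y) = det (complex_hessian h y)" if "y \<in> \<Omega>" for y
      using det_hermitian_pos_def[OF bspec[OF pos_def that]] by (simp add: complex_eq_iff)
    have "?d differentiable (at w)"
      using differentiable_det[OF matrix_differentiable_hessian[OF w]]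
      by (rule differentiable_bounded_linear[OF bounded_linear_Re])
    then have "wd \<i> j (\<lambda>w. complex_of_real (ln (?d w))) w = wd \<i> j (\<lambda>w. complex_of_real (?d w)) w / det (complex_hessian h w)"
      using det_hermitian_pos_def[OF bspec[OF pos_def w]] by (simp add: wd_ln real w)
    also have "wd \<i> j (\<lambda>w. complex_of_real (?d w)) w = wd \<i> j (\<lambda>w. det (complex_hessian h w)) w"
      by (rule wd_cong_open[OF open_dom w real])
    also have "\<dots> = det (complex_hessian h w) * trace (matrix_inv (complex_hessian h w) ** matrix_wd \<i> j (complex_hessian h) w)"
      by (rule wd_det[OF matrix_differentiable_hessian[OF w] inv_hessian[OF w]])
    finally show ?thesis
      using inv_hessian[OF w] by (simp add: invertible_det_nz)
  qed
  then have "wd (- \<i>) i (wd \<i> j (\<lambda>w. complex_of_real (ln (?d w)))) z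
      = wd (- \<i>) i (\<lambda>w. trace (matrix_inv (complex_hessian h w) ** matrix_wd \<i> j (complex_hessian h) w)) z"
    by (rule wd_cong_open[OF open_dom z])
  also have "\<dots> = trace (matrix_inv (complex_hessian h z) ** matrix_wd (- \<i>) i (matrix_wd \<i> j (complex_hessian h)) z)
      - trace (matrix_inv (complex_hessian h z) ** matrix_wd (- \<i>) i (complex_hessian h) z ** matrix_inv (complex_hessian h z) ** matrix_wd \<i> j (complex_hessian h) z)"
    by (rule wd_trace_inverse_mult[OF open_dom z inv_hessian matrix_differentiable_hessian[OF z]
          matrix_differentiable_wd_hessian[OF z]])
  finally show ?thesis
    using matrix_wd_hessian_ctrans[OF z, of "- \<i>" j]
    by (simp add: ricci_matrix_def ricci_def complex_hessian_nth)
qed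

text \<open>The transposition in \<open>inv_metric\<close> makes the quadratic term a plain product
  of three matrices, whose last factor is the adjoint of an unbarred derivative.\<close>

lemma curvature_eq:
  assumes z: "z \<in> \<Omega>"
  shows "curvature h z i j k l = curvature_matrix (matrix_inv (complex_hessian h z)) (\<lambda>k. matrix_wd (- \<i>) k (complex_hessian h) z)
    (\<lambda>k l. matrix_wd (- \<i>) k (matrix_wd \<i> l (complex_hessian h)) z) $ (i, k) $ (j, l)"
proof -
  have "(\<Sum>p\<in>UNIV. \<Sum>q\<in>UNIV. inv_metric h z p q * wd (- \<i>) k (\<lambda>w. complex_hessian h w $ i $ q) z * wd \<i> l (\<lambda>w. complex_hessian h w $ p $ j) z)
    = (matrix_wd (- \<i>) k (complex_hessian h) z ** matrix_inv (complex_hessian h z) ** matrix_wd \<i> l (complex_hessian h) z) $ i $ j"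
    by (simp add: matrix_matrix_mult_def inv_metric_def sum_distrib_left sum_distrib_right mult_ac)
  then show ?thesis
    using matrix_wd_hessian_ctrans[OF z, of "- \<i>" l]
    by (simp add: curvature_def curvature_matrix_def d_z_eq_wd d_zbar_eq_wd matrix_wd_nth[abs_def])
qed

end

section \<open>The tensor norms as traces of matrix products\<close>

lemma trace_mult4:
  fixes A B C D :: "complex^'n::finite^'n"
  shows "trace (A ** B ** C ** D) = (\<Sum>a\<in>UNIV. \<Sum>c\<in>UNIV. \<Sum>b\<in>UNIV. \<Sum>d\<in>UNIV.
    A $ a $ b * B $ b $ c * (C $ c $ d * D $ d $ a))"
proof -
  have "trace (A ** B ** C ** D) = trace ((A ** B) ** (C ** D))"
    by (simp add: matrix_mul_assoc)
  also have "\<dots> = (\<Sum>a\<in>UNIV. \<Sum>c\<in>UNIV. (\<Sum>b\<in>UNIV. A $ a $ b * B $ b $ c) * (\<Sum>d\<in>UNIV. C $ c $ d * D $ d $ a))"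
    unfolding trace_mult_eq_sum by (simp add: matrix_matrix_mult_def)
  finally show ?thesis
    by (simp add: sum_product)
qed

lemma ricci_norm_eq:
  fixes h :: "complex^'n::finite \<Rightarrow> real"
  assumes "\<And>i j. ricci h z i j = Ric $ i $ j" and P: "P = matrix_inv (complex_hessian h z)"
  shows "ricci_norm h z = sqrt (Re (trace (P ** Ric ** P ** Ric)))"
proof -
  let ?t = "\<lambda>i j k l. P $ j $ i * P $ l $ k * Ric $ i $ l * Ric $ k $ j"
  have "(\<Sum>i\<in>UNIV. \<Sum>j\<in>UNIV. \<Sum>k\<in>UNIV. \<Sum>l\<in>UNIV. ?t i j k l) = (\<Sum>(i, j, k, l)\<in>UNIV. ?t i j k l)"
    by (simp add: sum_UNIV_prod)
  \<comment> \<open>The trace runs through the indices in the cycle \<open>j\<close>,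
    \<open>i\<close>, \<open>l\<close>, \<open>k\<close>; \<open>trace_mult4\<close> sums over the
    first and third of these before the second and fourth.\<close>
  also have "\<dots> = (\<Sum>(j, l, i, k)\<in>UNIV. ?t i j k l)"
    by (rule sum.reindex_bij_witness[of _ "\<lambda>(j, l, i, k). (i, j, k, l)" "\<lambda>(i, j, k, l). (j, l, i, k)"]) auto
  also have "\<dots> = trace (P ** Ric ** P ** Ric)"
    by (simp add: sum_UNIV_prod trace_mult4 mult_ac)
  finally show ?thesis
    by (simp add: ricci_norm_def inv_metric_def assms flip: P)
qed

lemma curvature_norm_eq:
  fixes h :: "complex^'n::finite \<Rightarrow> real"
  assumes "\<And>i j k l. curvature h z i j k l = R $ (i, k) $ (j, l)" and Q: "Q = matrix_inv (complex_hessian h z)"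
  shows "curvature_norm h z = sqrt (Re (trace (kron Q Q ** R ** kron Q Q ** R)))"
proof -
  let ?t = "\<lambda>m n k l i j s t. Q $ n $ m * Q $ l $ k * Q $ j $ i * Q $ t $ s * R $ (m, i) $ (l, t) * R $ (k, s) $ (n, j)"
  have "(\<Sum>m\<in>UNIV. \<Sum>n\<in>UNIV. \<Sum>k\<in>UNIV. \<Sum>l\<in>UNIV. \<Sum>i\<in>UNIV. \<Sum>j\<in>UNIV. \<Sum>s\<in>UNIV. \<Sum>t\<in>UNIV. ?t m n k l i j s t)
    = (\<Sum>(m, n, k, l, i, j, s, t)\<in>UNIV. ?t m n k l i j s t)"
    by (simp add: sum_UNIV_prod)
  \<comment> \<open>The same pattern on pairs: the cycle is \<open>(l, t)\<close>,
    \<open>(k, s)\<close>, \<open>(n, j)\<close>, \<open>(m, i)\<close>.\<close>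
  also have "\<dots> = (\<Sum>(l, t, n, j, k, s, m, i)\<in>UNIV. ?t m n k l i j s t)"
    by (rule sum.reindex_bij_witness[of _ "\<lambda>(l, t, n, j, k, s, m, i). (m, n, k, l, i, j, s, t)"
          "\<lambda>(m, n, k, l, i, j, s, t). (l, t, n, j, k, s, m, i)"]) auto
  also have "\<dots> = trace (kron Q Q ** R ** kron Q Q ** R)"
    by (simp add: sum_UNIV_prod trace_mult4 mult_ac)
  finally show ?thesis
    by (simp add: curvature_norm_def inv_metric_def assms flip: Q)
qed

section \<open>From the pointwise estimate to the potentials \<open>f\<close> and
  \<open>g\<close>\<close>

theorem lemma5p2:
  fixes \<Omega> :: "(complex^'n::finite) set"
    and f g \<phi> :: "complex^'n \<Rightarrow> real"
  assumes "open \<Omega>" and "connected \<Omega>"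
    and "smooth_on f \<Omega>" and "smooth_on g \<Omega>"
    and "\<And>z. z \<in> \<Omega> \<Longrightarrow> hermitian_pos_def (complex_hessian f z)"
    and "\<And>z. z \<in> \<Omega> \<Longrightarrow> hermitian_pos_def (complex_hessian g z)"
    and "\<And>z. z \<in> \<Omega> \<Longrightarrow> \<phi> z = f z - g z"
    and "z \<in> \<Omega>"
  shows "complex_laplacian f (\<lambda>w. ln (real CARD('n) - complex_laplacian f \<phi> w)) z
           \<ge> - ricci_norm f z - curvature_norm g z * (real CARD('n) - complex_laplacian f \<phi> z)"
proof -
  have "\<forall>z\<in>\<Omega>. hermitian_pos_def (complex_hessian f z)" "\<forall>z\<in>\<Omega>. hermitian_pos_def (complex_hessian g z)"
    using assms(5,6) by blast+
  note f = assms(1,3) this(1) and g = assms(1,4) this(2)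
  define F where "F = complex_hessian f"
  define G where "G = complex_hessian g"
  define P where "P w = matrix_inv (F w)" for w
  \<comment> \<open>The trace is differentiated as the complex function \<open>U\<close>, to which
    the matrix rules apply; on \<Omega> it takes the real values \<open>u\<close>.\<close>
  define U where "U w = trace (P w ** G w)" for w
  define u where "u w = Re (U w)" for w
  define F1 where "F1 k = matrix_wd (- \<i>) k F z" for k
  define G1 where "G1 k = matrix_wd (- \<i>) k G z" for k
  define F2 where "F2 k l = matrix_wd (- \<i>) k (matrix_wd \<i> l F) z" for k l
  define G2 where "G2 k l = matrix_wd (- \<i>) k (matrix_wd \<i> l G) z" for k l
  define Ric where "Ric = ricci_matrix (P z) F1 F2"
  define R where "R = curvature_matrix (matrix_inv (G z)) G1 G2"
  let ?n = "real CARD('n)"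

  note dF = matrix_differentiable_hessian[OF f, folded F_def]
    and dG = matrix_differentiable_hessian[OF g, folded G_def]
    and dF1 = matrix_differentiable_wd_hessian[OF f, folded F_def]
    and dG1 = matrix_differentiable_wd_hessian[OF g, folded G_def]
    and dP = matrix_differentiable_inv_hessian[OF f, folded F_def, folded P_def]
    and invF = inv_hessian[OF f, folded F_def]
  have wd_tr: "wd s k (\<lambda>w. trace (P w ** B w)) w
      = trace (P w ** matrix_wd s k B w) - trace (P w ** matrix_wd s k F w ** P w ** B w)"
    if "w \<in> \<Omega>" "matrix_differentiable B w" for s k B w
    unfolding P_def by (rule wd_trace_inverse_mult[OF assms(1) that(1) invF dF[OF that(1)] that(2)])
  have PF: "P w ** F w = mat 1" if "w \<in> \<Omega>" for w
    unfolding P_def by (rule matrix_inv_inverse(2)[OF invF[OF that]])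

  have UF: "U w = of_real (u w)" and u_pos: "u w > 0" if "w \<in> \<Omega>" for w
  proof -
    have "hermitian_pos_def (F w)" "hermitian_pos_def (G w)"
      using assms(5,6) that by (simp_all add: F_def G_def)
    from trace_matrix_inv_mult_real[OF this] trace_matrix_inv_mult_pos[OF this]
    show "U w = of_real (u w)" "u w > 0"
      by (simp_all add: complex_eq_iff U_def u_def P_def)
  qed

  \<comment> \<open>The Hessian of \<phi> is \<open>F - G\<close>, and the trace of
    \<open>P ** F\<close> is the dimension. The identity is needed on all of \<Omega> since its
    logarithm is differentiated.\<close>
  have lap_phi: "complex_laplacian f \<phi> w = ?n - u w" if w: "w \<in> \<Omega>" for w
  proof -
    have cf: "smooth_on (\<lambda>w. complex_of_real (f w)) \<Omega>" and cg: "smooth_on (\<lambda>w. complex_of_real (g w)) \<Omega>"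
      using smooth_complex[OF f] smooth_complex[OF g] .
    have "wd \<i> j (\<lambda>w. complex_of_real (\<phi> w)) y
        = wd \<i> j (\<lambda>w. complex_of_real (f w)) y - wd \<i> j (\<lambda>w. complex_of_real (g w)) y" if y: "y \<in> \<Omega>" for y j
    proof -
      have "wd \<i> j (\<lambda>w. complex_of_real (\<phi> w)) y = wd \<i> j (\<lambda>w. complex_of_real (f w) - complex_of_real (g w)) y"
        by (rule wd_cong_open[OF assms(1) y]) (simp add: assms(7))
      then show ?thesis
        by (simp add: wd_diff smooth_on_imp_differentiable[OF cf y] smooth_on_imp_differentiable[OF cg y])
    qed
    then have "wd (- \<i>) i (wd \<i> j (\<lambda>w. complex_of_real (\<phi> w))) w
        = wd (- \<i>) i (\<lambda>y. wd \<i> j (\<lambda>w. complex_of_real (f w)) y - wd \<i> j (\<lambda>w. complex_of_real (g w)) y) w" for i j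
      by (rule wd_cong_open[OF assms(1) w])
    also have "\<dots> i j = F w $ i $ j - G w $ i $ j" for i j
      unfolding F_def G_def complex_hessian_nth
      by (intro wd_diff smooth_on_imp_differentiable[OF _ w] smooth_on_wd assms(1) cf cg)
    finally have "complex_hessian \<phi> w = F w - G w"
      by (simp add: vec_eq_iff complex_hessian_nth)
    then have "complex_laplacian f \<phi> w = Re (\<Sum>i\<in>UNIV. \<Sum>j\<in>UNIV. P w $ j $ i * (F w - G w) $ i $ j)"
      by (simp add: complex_laplacian_def inv_metric_def P_def F_def)
    also have "(\<Sum>i\<in>UNIV. \<Sum>j\<in>UNIV. P w $ j $ i * (F w - G w) $ i $ j) = trace (P w ** (F w - G w))"
      unfolding trace_mult_eq_sum by (rule sum.swap)
    also have "\<dots> = of_nat CARD('n) - U w"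
      by (simp add: matrix_diff_ldistrib trace_sub PF w trace_I U_def)
    finally show ?thesis
      by (simp add: u_def)
  qed

  have dU: "U differentiable (at w)" if "w \<in> \<Omega>" for w
    unfolding U_def by (intro differentiable_trace matrix_differentiable_mult dP dG that)
  have U1: "wd s l U w = trace (P w ** matrix_wd s l G w) - trace (P w ** matrix_wd s l F w ** P w ** G w)"
    if "w \<in> \<Omega>" for s l w
    unfolding U_def by (rule wd_tr[OF that dG[OF that]])
  \<comment> \<open>Differentiability is read off from the explicit formula \<open>U1\<close>, which
    holds throughout \<Omega>.\<close>
  have dU1: "wd s l U differentiable (at z)" for s l
  proof -
    have "(\<lambda>w. trace (P w ** matrix_wd s l G w) - trace (P w ** matrix_wd s l F w ** P w ** G w)) differentiable (at z)"
      by (intro differentiable_diff differentiable_trace matrix_differentiable_mult dP dG dF1 dG1 assms(8))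
    then show ?thesis
      by (subst differentiable_cong_open[OF assms(1,8) U1])
  qed
  have U2: "wd (- \<i>) k (wd \<i> l U) z = trace (P z ** G2 k l) - trace (P z ** F1 k ** P z ** ctrans (G1 l))
      - trace (P z ** ctrans (F1 l) ** P z ** G1 k) + trace (P z ** F1 k ** P z ** ctrans (F1 l) ** P z ** G z)
      + trace (P z ** ctrans (F1 l) ** P z ** F1 k ** P z ** G z) - trace (P z ** F2 k l ** P z ** G z)" for k l
  proof -
    let ?Fl = "matrix_wd \<i> l F" and ?Gl = "matrix_wd \<i> l G"
    have z: "z \<in> \<Omega>" by (rule assms(8))
    have adj: "?Fl z = ctrans (F1 l)" "?Gl z = ctrans (G1 l)"
      using matrix_wd_hessian_ctrans[OF f z, of "- \<i>" l] matrix_wd_hessian_ctrans[OF g z, of "- \<i>" l]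
      by (simp_all add: F_def G_def F1_def G1_def)
    \<comment> \<open>The second trace is bracketed as \<open>P w\<close> times a matrix function,
      so that \<open>wd_tr\<close> applies to it as well.\<close>
    have "wd (- \<i>) k (wd \<i> l U) z
      = wd (- \<i>) k (\<lambda>w. trace (P w ** ?Gl w) - trace (P w ** (?Fl w ** P w ** G w))) z"
      by (rule wd_cong_open[OF assms(1) z]) (simp add: U1 matrix_mul_assoc)
    also have "\<dots> = wd (- \<i>) k (\<lambda>w. trace (P w ** ?Gl w)) z - wd (- \<i>) k (\<lambda>w. trace (P w ** (?Fl w ** P w ** G w))) z"
      by (intro wd_diff differentiable_trace matrix_differentiable_mult dP dG dF1 dG1 z)
    also have "wd (- \<i>) k (\<lambda>w. trace (P w ** ?Gl w)) z = trace (P z ** G2 k l) - trace (P z ** F1 k ** P z ** ctrans (G1 l))"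
      unfolding G2_def F1_def adj(2)[symmetric] by (rule wd_tr[OF z dG1[OF z]])
    also have "wd (- \<i>) k (\<lambda>w. trace (P w ** (?Fl w ** P w ** G w))) z
      = trace (P z ** matrix_wd (- \<i>) k (\<lambda>w. ?Fl w ** P w ** G w) z) - trace (P z ** F1 k ** P z ** (?Fl z ** P z ** G z))"
      unfolding F1_def by (rule wd_tr[OF z]) (intro matrix_differentiable_mult dP dG dF1 z)
    also have "matrix_wd (- \<i>) k (\<lambda>w. ?Fl w ** P w ** G w) z
      = (F2 k l ** P z - ?Fl z ** (P z ** F1 k ** P z)) ** G z + ?Fl z ** P z ** G1 k"
    proof -
      have "matrix_wd (- \<i>) k P z = - (P z ** F1 k ** P z)"
        unfolding P_def[abs_def] F1_def by (rule matrix_wd_inverse[OF assms(1) z invF dF[OF z]])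
      then show ?thesis
        by (simp add: matrix_wd_mult matrix_differentiable_mult dP dG dF1 z F2_def G1_def matrix_minus_mult)
    qed
    finally show ?thesis
      by (simp add: adj matrix_add_ldistrib matrix_diff_ldistrib matrix_diff_rdistrib matrix_mul_assoc
          trace_add trace_sub algebra_simps)
  qed

  have hess: "complex_hessian (\<lambda>w. ln (?n - complex_laplacian f \<phi> w)) z $ k $ l
    = wd (- \<i>) k (wd \<i> l U) z / of_real (u z) - wd (- \<i>) k U z * cnj (wd (- \<i>) l U z) / (of_real (u z))\<^sup>2" for k l
  proof -
    have ln: "wd \<i> l (\<lambda>w. complex_of_real (ln (?n - complex_laplacian f \<phi> w))) w = wd \<i> l U w / U w" if w: "w \<in> \<Omega>" for w
    proof -
      have "wd \<i> l (\<lambda>w. complex_of_real (ln (?n - complex_laplacian f \<phi> w))) w = wd \<i> l (\<lambda>w. complex_of_real (ln (u w))) w"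
        by (rule wd_cong_open[OF assms(1) w]) (simp add: lap_phi)
      also have "\<dots> = wd \<i> l (\<lambda>w. complex_of_real (u w)) w / of_real (u w)"
        unfolding u_def using u_pos[OF w] differentiable_bounded_linear[OF bounded_linear_Re dU[OF w]]
        by (intro wd_ln) (simp_all add: u_def)
      also have "wd \<i> l (\<lambda>w. complex_of_real (u w)) w = wd \<i> l U w"
        by (rule wd_cong_open[OF assms(1) w]) (simp add: UF)
      finally show ?thesis by (simp add: UF w)
    qed
    \<comment> \<open>Since \<open>U\<close> is real on \<Omega>, its barred derivative is the
      conjugate of the unbarred one; this produces the hermitian square in the Hessian of the
      logarithm.\<close>
    have "wd \<i> l U z = wd \<i> l (\<lambda>w. cnj (U w)) z"
      by (rule wd_cong_open[OF assms(1,8)]) (simp add: UF)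
    also have "\<dots> = cnj (wd (- \<i>) l U z)"
      by (simp add: wd_cnj dU assms(8))
    finally have cnj: "wd \<i> l U z = cnj (wd (- \<i>) l U z)" .
    have "complex_hessian (\<lambda>w. ln (?n - complex_laplacian f \<phi> w)) z $ k $ l = wd (- \<i>) k (\<lambda>w. wd \<i> l U w / U w) z"
      unfolding complex_hessian_nth by (rule wd_cong_open[OF assms(1,8) ln])
    also have "\<dots> = wd (- \<i>) k (wd \<i> l U) z / U z - wd \<i> l U z * wd (- \<i>) k U z / (U z)\<^sup>2"
      using u_pos[OF assms(8)] by (intro wd_divide dU dU1 assms(8)) (simp add: UF assms(8))
    finally show ?thesis
      by (simp add: UF assms(8) cnj mult.commute)
  qed

  have "complex_laplacian f (\<lambda>w. ln (?n - complex_laplacian f \<phi> w)) z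
    = Re (\<Sum>k\<in>UNIV. \<Sum>l\<in>UNIV. P z $ l $ k * (wd (- \<i>) k (wd \<i> l U) z / of_real (u z)
        - wd (- \<i>) k U z * cnj (wd (- \<i>) l U z) / (of_real (u z))\<^sup>2))"
    unfolding complex_laplacian_def[of f "\<lambda>w. ln (?n - complex_laplacian f \<phi> w)"] hess
    by (simp add: inv_metric_def P_def F_def)
  also have "\<dots> \<ge> - sqrt (Re (trace (P z ** Ric ** P z ** Ric)))
      - sqrt (Re (trace (kron (matrix_inv (G z)) (matrix_inv (G z)) ** R ** kron (matrix_inv (G z)) (matrix_inv (G z)) ** R))) * u z"
    unfolding U2 U1[OF assms(8)] Ric_def R_def u_def U_def P_def F1_def[symmetric] G1_def[symmetric]
  proof (rule laplacian_log_trace_estimate)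
    show "hermitian_pos_def (F z)" "hermitian_pos_def (G z)"
      using assms(5,6,8) by (simp_all add: F_def G_def)
    show "ctrans (F2 k l) = F2 l k" "ctrans (G2 k l) = G2 l k" for k l
      unfolding F2_def G2_def F_def G_def
      by (rule matrix_wd2_hessian_ctrans[OF f assms(8)] matrix_wd2_hessian_ctrans[OF g assms(8)])+
    show "F1 k $ i $ j = F1 i $ k $ j" for i j k
      unfolding F1_def F_def by (rule wd_hessian_symmetric[OF f assms(8)])
    show "F2 k l $ i $ j = F2 i j $ k $ l" for i j k l
      unfolding F2_def F_def by (rule wd2_hessian_symmetric[OF f assms(8)])
  qed
  also have "sqrt (Re (trace (P z ** Ric ** P z ** Ric))) = ricci_norm f z"
    by (rule ricci_norm_eq[symmetric])
      (simp_all add: ricci_eq[OF f assms(8)] Ric_def P_def F1_def[abs_def] F2_def[abs_def] F_def)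
  also have "sqrt (Re (trace (kron (matrix_inv (G z)) (matrix_inv (G z)) ** R ** kron (matrix_inv (G z)) (matrix_inv (G z)) ** R)))
      = curvature_norm g z"
    by (rule curvature_norm_eq[symmetric])
      (simp_all add: curvature_eq[OF g assms(8)] R_def G1_def[abs_def] G2_def[abs_def] G_def)
  finally show ?thesis
    by (simp add: lap_phi assms(8))
qed

end
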